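(* Let $F$ be a Banach space and $\mathcal T$ a topology on $F$ for which a functional on $F$ is $\mathcal T$-continuous if and only if it is norm continuous (equivalently, $\mathcal T$ contains the weak topology and is contained in the norm topology). Let $E_1,\dots,E_n$ be normed spaces. A bounded $n$-linear map $T: E_1\times\dots\times E_n\to F$ is compact with respect to $\mathcal T$ if and only if the bounded linear map $\widetilde T:\widehat\bigotimes_{i=1}^n E_i\to F$ with $\widetilde T(x_1\hat\otimes\dots\hat\otimes x_n)=T(x_1,\dots,x_n)$ ($x_i\in E_i$) is compact with respect to $\mathcal T$.
   Context: For a normed space $E$, $\mathrm{ball}(E)$ denotes the open unit ball of $E$. Let $E_1,\dots,E_n$ be normed spaces and $F$ a vector space with a topology $\mathcal T$ defined on it. An $n$-linear map $T:E_1\times\dots\times E_n\to F$ is compact with respect to $\mathcal T$ if the closure in $\mathcal T$ of $T(\{(x_1,\dots,x_n):x_i\in\mathrm{ball}(E_i)\})$ is compact when considered as a topological space with the subspace topology induced by $\mathcal T$; for linear maps this is the case $n=1$. $\widehat\bigotimes_{i=1}^n E_i$ is the (completed) projective tensor product of $E_1,\dots,E_n$. For every bounded $n$-linear map $T:E_1\times\dots\times E_n\to F$ with $F$ a Banach space, there is a unique bounded linear map $\widetilde T:\widehat\bigotimes_{i=1}^n E_i\to F$ with $\widetilde T(x_1\hat\otimes\dots\hat\otimes x_n)=T(x_1,\dots,x_n)$ for all $x_i\in E_i$, and $T\mapsto\widetilde T$ is an isometric isomorphism of Banach spaces.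
   Formalization: The topology on F is additionally assumed to be a locally convex vector topology; for an arbitrary topology, even one between the weak and the norm topology, the claim is false. *)

theory Defs
  imports "HOL-Analysis.Analysis"
begin

text \<open>
  Scalars range over a type \<open>'k :: {real_normed_field, euclidean_space}\<close>. Such a field is a
  commutative real division algebra of finite dimension, so \<open>'k\<close> is \<open>\<real>\<close> or \<open>\<complex>\<close>. A normed space over
  \<open>'k\<close> is a type of class \<open>real_normed_vector\<close> together with a scalar multiplication \<open>s\<close> by \<open>'k\<close>
  that extends \<open>scaleR\<close> and for which the norm is homogeneous; it is a Banach space over \<open>'k\<close> if the
  type is of class \<open>banach\<close>.
\<close>

definition normed_scaling ::
    "('k::{real_normed_field, euclidean_space} \<Rightarrow> 'v::real_normed_vector \<Rightarrow> 'v) \<Rightarrow> bool"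
  where "normed_scaling s \<longleftrightarrow>
    vector_space s \<and>
    (\<forall>r x. s (of_real r) x = r *\<^sub>R x) \<and>
    (\<forall>c x. norm (s c x) = norm c * norm x)"

text \<open>
  The spaces \<open>E\<^sub>1, \<dots>, E\<^sub>n\<close> may all be different, but a family indexed by \<open>'n\<close> has a single element
  type. They are therefore linear subspaces \<open>E i\<close> of one normed space \<open>'a\<close>, with the induced norm.
  This is no restriction, since arbitrary normed spaces embed isometrically in their direct sum.
  The number of spaces is \<open>CARD('n)\<close>, and a tuple is a function \<open>x\<close> with \<open>x i \<in> E i\<close> for all \<open>i\<close>.
\<close>

definition tuples :: "('n \<Rightarrow> 'a set) \<Rightarrow> ('n \<Rightarrow> 'a) set"
  where "tuples E = {x. \<forall>i. x i \<in> E i}"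

definition ball_tuples :: "('n \<Rightarrow> 'a::real_normed_vector set) \<Rightarrow> ('n \<Rightarrow> 'a) set"
  where "ball_tuples E = {x. \<forall>i. x i \<in> E i \<inter> ball 0 1}"

text \<open>Only the values of \<open>f\<close> on \<open>tuples E\<close> matter.\<close>

definition multilinear_on ::
    "('k \<Rightarrow> 'a::ab_group_add \<Rightarrow> 'a) \<Rightarrow> ('k \<Rightarrow> 'b::ab_group_add \<Rightarrow> 'b) \<Rightarrow>
     ('n \<Rightarrow> 'a set) \<Rightarrow> (('n \<Rightarrow> 'a) \<Rightarrow> 'b) \<Rightarrow> bool"
  where "multilinear_on s t E f \<longleftrightarrow>
    (\<forall>x\<in>tuples E. \<forall>i.
       (\<forall>y\<in>E i. \<forall>z\<in>E i. f (x(i := y + z)) = f (x(i := y)) + f (x(i := z))) \<and>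
       (\<forall>c. \<forall>y\<in>E i. f (x(i := s c y)) = t c (f (x(i := y)))))"

definition bounded_multilinear_on ::
    "('k \<Rightarrow> 'a::real_normed_vector \<Rightarrow> 'a) \<Rightarrow> ('k \<Rightarrow> 'b::real_normed_vector \<Rightarrow> 'b) \<Rightarrow>
     ('n::finite \<Rightarrow> 'a set) \<Rightarrow> (('n \<Rightarrow> 'a) \<Rightarrow> 'b) \<Rightarrow> bool"
  where "bounded_multilinear_on s t E f \<longleftrightarrow>
    multilinear_on s t E f \<and>
    (\<exists>C. \<forall>x\<in>tuples E. norm (f x) \<le> C * (\<Prod>i\<in>UNIV. norm (x i)))"

text \<open>
  The algebraic tensor product of the \<open>E i\<close> consists of functionals on the space of all \<open>n\<close>-linear
  forms on the \<open>E i\<close>: the tensor \<open>x\<^sub>1 \<otimes> \<dots> \<otimes> x\<^sub>n\<close> is evaluation at \<open>x\<close>, and the tensor product is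
  the span of these. (A functional is made zero at functions that are not \<open>n\<close>-linear forms, so that
  equality of functionals is equality in HOL. Scalars are absorbed in a factor, so that finite sums
  of elementary tensors suffice.)
\<close>

definition tensor ::
    "('k::real_normed_field \<Rightarrow> 'a::ab_group_add \<Rightarrow> 'a) \<Rightarrow> ('n \<Rightarrow> 'a set) \<Rightarrow> ('n \<Rightarrow> 'a) \<Rightarrow>
     (('n \<Rightarrow> 'a) \<Rightarrow> 'k) \<Rightarrow> 'k"
  where "tensor s E x = (\<lambda>\<phi>. if multilinear_on s (*) E \<phi> then \<phi> x else 0)"

definition alg_tensor_product ::
    "('k::real_normed_field \<Rightarrow> 'a::ab_group_add \<Rightarrow> 'a) \<Rightarrow> ('n \<Rightarrow> 'a set) \<Rightarrow>
     ((('n \<Rightarrow> 'a) \<Rightarrow> 'k) \<Rightarrow> 'k) set"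
  where "alg_tensor_product s E =
    {u. \<exists>m::nat. \<exists>X. (\<forall>j<m. X j \<in> tuples E) \<and> u = (\<lambda>\<phi>. \<Sum>j<m. tensor s E (X j) \<phi>)}"

definition projective_norm ::
    "('k::real_normed_field \<Rightarrow> 'a::real_normed_vector \<Rightarrow> 'a) \<Rightarrow> ('n::finite \<Rightarrow> 'a set) \<Rightarrow>
     ((('n \<Rightarrow> 'a) \<Rightarrow> 'k) \<Rightarrow> 'k) \<Rightarrow> real"
  where "projective_norm s E u =
    Inf {(\<Sum>j<m. \<Prod>i\<in>UNIV. norm (X j i)) | (m::nat) X.
           (\<forall>j<m. X j \<in> tuples E) \<and> u = (\<lambda>\<phi>. \<Sum>j<m. tensor s E (X j) \<phi>)}"

text \<open>
  The Banach space \<open>'p\<close> with scalar multiplication \<open>p\<close> is the completion of the algebraic tensor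
  product under the projective norm, with \<open>\<iota>\<close> as the canonical inclusion. In \<open>'p\<close>, the element
  \<open>x\<^sub>1 \<otimes> \<dots> \<otimes> x\<^sub>n\<close> is \<open>\<iota> (tensor s E x)\<close>.
\<close>

definition projective_tensor_product ::
    "('k::{real_normed_field, euclidean_space} \<Rightarrow> 'a::real_normed_vector \<Rightarrow> 'a) \<Rightarrow>
     ('n::finite \<Rightarrow> 'a set) \<Rightarrow> ('k \<Rightarrow> 'p::banach \<Rightarrow> 'p) \<Rightarrow>
     (((('n \<Rightarrow> 'a) \<Rightarrow> 'k) \<Rightarrow> 'k) \<Rightarrow> 'p) \<Rightarrow> bool"
  where "projective_tensor_product s E p \<iota> \<longleftrightarrow>
    normed_scaling p \<and>
    (\<forall>u\<in>alg_tensor_product s E. \<forall>v\<in>alg_tensor_product s E. \<iota> (\<lambda>\<phi>. u \<phi> + v \<phi>) = \<iota> u + \<iota> v) \<and>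
    (\<forall>c. \<forall>u\<in>alg_tensor_product s E. \<iota> (\<lambda>\<phi>. c * u \<phi>) = p c (\<iota> u)) \<and>
    (\<forall>u\<in>alg_tensor_product s E. norm (\<iota> u) = projective_norm s E u) \<and>
    closure (\<iota> ` alg_tensor_product s E) = UNIV"

text \<open>
  Local convexity is what makes the condition on functionals in \<open>compatible_topology\<close> equivalent to
  \<open>\<T>\<close> lying between the weak and the norm topology.
\<close>

definition locally_convex_topology ::
    "('k::{real_normed_field, euclidean_space} \<Rightarrow> 'f::real_normed_vector \<Rightarrow> 'f) \<Rightarrow>
     'f topology \<Rightarrow> bool"
  where "locally_convex_topology t \<T> \<longleftrightarrow>
    topspace \<T> = UNIV \<and>
    continuous_map (prod_topology \<T> \<T>) \<T> (\<lambda>(x, y). x + y) \<and>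
    continuous_map (prod_topology euclidean \<T>) \<T> (\<lambda>(c, x). t c x) \<and>
    (\<forall>U. openin \<T> U \<and> 0 \<in> U \<longrightarrow> (\<exists>V. openin \<T> V \<and> 0 \<in> V \<and> V \<subseteq> U \<and> convex V))"

definition compatible_topology ::
    "('k::{real_normed_field, euclidean_space} \<Rightarrow> 'f::real_normed_vector \<Rightarrow> 'f) \<Rightarrow>
     'f topology \<Rightarrow> bool"
  where "compatible_topology t \<T> \<longleftrightarrow>
    locally_convex_topology t \<T> \<and>
    (\<forall>f :: 'f \<Rightarrow> 'k. Vector_Spaces.linear t (*) f \<longrightarrow>
       (continuous_map \<T> euclidean f \<longleftrightarrow> continuous_on UNIV f))"

text \<open>
  \<open>B\<close> is the set on which the map is tested: \<open>ball_tuples E\<close> for an \<open>n\<close>-linear map, the open unit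
  ball for a linear map.
\<close>

definition compact_map_wrt :: "'f topology \<Rightarrow> 'b set \<Rightarrow> ('b \<Rightarrow> 'f) \<Rightarrow> bool"
  where "compact_map_wrt \<T> B T \<longleftrightarrow> compactin \<T> (\<T> closure_of (T ` B))"

end

theory Submission
  imports Defs
begin

text \<open>
  If \<open>Tt\<close> is compact, so is \<open>T\<close>, because \<open>\<iota>\<close> maps the tensors of tuples of the open unit balls into
  the open unit ball. Conversely, let \<open>S\<close> be the image of these tuples under \<open>T\<close>. Up to the factor
  \<open>2 ^ n\<close>, \<open>Tt\<close> maps the unit ball into the norm closure of the convex hull of \<open>S\<close>, hence into its
  \<open>\<T>\<close>-closure, and the claim is Krein's theorem: the \<open>\<T>\<close>-closed convex hull of \<open>S\<close> is \<open>\<T>\<close>-compact.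

  Let \<open>F\<close> be an ultrafilter on the closed convex hull and \<open>z f = lim f\<close> along \<open>F\<close>, an element of the
  bidual. If \<open>z\<close> had positive distance to the space, one could choose alternately functionals \<open>f\<^sub>n\<close>
  of norm 1 that vanish on a finite subset \<open>G\<^sub>n\<close> of \<open>S\<close> while \<open>z f\<^sub>n\<close> stays large, and points of the
  convex hull of \<open>G\<^sub>n\<^sub>+\<^sub>1\<close> at which \<open>f\<^sub>0, \<dots>, f\<^sub>n\<close> are large. Then \<open>f\<^sub>n\<close> tends to 0 pointwise on the
  compact closure of the union of the \<open>G\<^sub>n\<close>, but no convex combination of the \<open>f\<^sub>n\<close> is uniformly
  small on it. This contradicts Simons' inequality, so \<open>F\<close> converges weakly. As the closed convex
  hull is totally bounded and \<open>\<T>\<close> has a base of convex sets, \<open>F\<close> also converges in \<open>\<T>\<close>.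
\<close>

subsection \<open>The Hahn--Banach theorem\<close>

definition sublinear :: "('v::real_vector \<Rightarrow> real) \<Rightarrow> bool"
  where "sublinear q \<longleftrightarrow> (\<forall>x y. q (x + y) \<le> q x + q y) \<and> (\<forall>r>0. \<forall>x. q (r *\<^sub>R x) = r * q x)"

lemma sublinear_add: "sublinear q \<Longrightarrow> q (x + y) \<le> q x + q y"
  by (simp add: sublinear_def)

lemma sublinear_scale: "sublinear q \<Longrightarrow> 0 < r \<Longrightarrow> q (r *\<^sub>R x) = r * q x"
  by (simp add: sublinear_def)

lemma sublinear_zero: "sublinear q \<Longrightarrow> q 0 = 0"
  using sublinear_scale[of q 2 0] by simp

lemma sublinear_minus: "sublinear q \<Longrightarrow> - q (- x) \<le> q x"
  using sublinear_add[of q x "- x"] sublinear_zero[of q] by simp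

text \<open>One inequality for scaling suffices: applied to \<open>inverse r\<close> and
  \<open>r *\<^sub>R x\<close> it yields the reverse one.\<close>

lemma sublinearI:
  assumes add: "\<And>x y. q (x + y) \<le> q x + q y"
    and scale: "\<And>r x. 0 < r \<Longrightarrow> q (r *\<^sub>R x) \<le> r * q x"
  shows "sublinear q"
  unfolding sublinear_def
proof (intro conjI allI impI)
  fix r :: real and x assume r: "0 < r"
  have "r * q x = r * q (inverse r *\<^sub>R (r *\<^sub>R x))" using r by simp
  also have "\<dots> \<le> r * (inverse r * q (r *\<^sub>R x))"
    using r by (intro mult_left_mono scale) auto
  also have "\<dots> = q (r *\<^sub>R x)" using r by simp
  finally show "q (r *\<^sub>R x) = r * q x" using scale[OF r, of x] by simp
qed (rule add)

lemma sublinear_norm: "sublinear (\<lambda>x. c * norm x)" if "0 \<le> c"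
  using that by (intro sublinearI) (simp_all add: distrib_left[symmetric] norm_triangle_ineq mult_left_mono)

text \<open>The infimum is finite because
  \<open>\<phi> m \<le> p (l m) \<le> p (x + l m) + p (- x)\<close> bounds it below by
  \<open>- p (- x)\<close>. The map \<open>l\<close> allows the cone to be parametrised, for
  instance a ray by \<open>t \<ge> 0\<close>.\<close>

lemma sublinear_inf_convolution:
  fixes p :: "'v::real_vector \<Rightarrow> real" and M :: "'w::real_vector set"
  assumes p: "sublinear p"
    and M: "0 \<in> M" "\<And>m n. m \<in> M \<Longrightarrow> n \<in> M \<Longrightarrow> m + n \<in> M"
           "\<And>r m. 0 < r \<Longrightarrow> m \<in> M \<Longrightarrow> r *\<^sub>R m \<in> M"
    and l: "linear l"
    and add: "\<And>m n. m \<in> M \<Longrightarrow> n \<in> M \<Longrightarrow> \<phi> m + \<phi> n \<le> \<phi> (m + n)"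
    and scale: "\<And>r m. 0 < r \<Longrightarrow> m \<in> M \<Longrightarrow> \<phi> (r *\<^sub>R m) = r * \<phi> m"
    and le: "\<And>m. m \<in> M \<Longrightarrow> \<phi> m \<le> p (l m)"
  defines "q \<equiv> \<lambda>x. INF m\<in>M. p (x + l m) - \<phi> m"
  shows "sublinear q" "q x \<le> p x" "m \<in> M \<Longrightarrow> q x \<le> p (x + l m) - \<phi> m"
proof -
  have lower: "- p (- x) \<le> p (x + l m) - \<phi> m" if "m \<in> M" for x m
    using sublinear_add[OF p, of "x + l m" "- x"] le[OF that] by simp
  have q_le: "q x \<le> p (x + l m) - \<phi> m" if "m \<in> M" for x m
    unfolding q_def by (rule cINF_lower[OF _ that]) (auto intro!: bdd_belowI2 lower)
  have q_ge: "c \<le> q x" if "\<And>m. m \<in> M \<Longrightarrow> c \<le> p (x + l m) - \<phi> m" for c x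
    unfolding q_def using M(1) that by (intro cINF_greatest) auto
  show "m \<in> M \<Longrightarrow> q x \<le> p (x + l m) - \<phi> m" by (rule q_le)
  have "\<phi> 0 = 0" using scale[of 2 0] M(1) by simp
  then show "q x \<le> p x" using q_le[OF M(1), of x] linear_0[OF l] by simp
  show "sublinear q"
  proof (rule sublinearI)
    fix x y
    have "q (x + y) - (p (x + l m) - \<phi> m) \<le> q y" if m: "m \<in> M" for m
    proof (rule q_ge)
      fix n assume n: "n \<in> M"
      have "q (x + y) \<le> p (x + y + l (m + n)) - \<phi> (m + n)"
        by (intro q_le M m n)
      also have "\<dots> \<le> p (x + l m) + p (y + l n) - (\<phi> m + \<phi> n)"
        using sublinear_add[OF p, of "x + l m" "y + l n"] add[OF m n]
        by (simp add: linear_add[OF l] algebra_simps)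
      finally show "q (x + y) - (p (x + l m) - \<phi> m) \<le> p (y + l n) - \<phi> n" by simp
    qed
    then have "q (x + y) - q y \<le> q x" by (intro q_ge) (simp add: algebra_simps)
    then show "q (x + y) \<le> q x + q y" by simp
  next
    fix r :: real and x assume r: "0 < r"
    have "q (r *\<^sub>R x) / r \<le> q x"
    proof (rule q_ge)
      fix m assume m: "m \<in> M"
      have "q (r *\<^sub>R x) \<le> p (r *\<^sub>R (x + l m)) - \<phi> (r *\<^sub>R m)"
        using q_le[OF M(3)[OF r m], of "r *\<^sub>R x"] by (simp add: linear_scale[OF l] scaleR_add_right)
      also have "\<dots> = r * (p (x + l m) - \<phi> m)"
        using sublinear_scale[OF p r] scale[OF r m] by (simp add: right_diff_distrib)
      finally show "q (r *\<^sub>R x) / r \<le> p (x + l m) - \<phi> m"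
        using r by (simp add: divide_le_eq mult.commute)
    qed
    then show "q (r *\<^sub>R x) \<le> r * q x" using r by (simp add: divide_le_eq mult.commute)
  qed
qed

text \<open>Zorn's lemma for the reversed pointwise order. The bound \<open>- p (- x)\<close> keeps
  the infimum of a chain finite.\<close>

lemma minimal_sublinear_exists:
  fixes p :: "'v::real_vector \<Rightarrow> real"
  assumes p: "sublinear p"
  shows "\<exists>m. sublinear m \<and> m \<le> p \<and> (\<forall>q. sublinear q \<longrightarrow> q \<le> m \<longrightarrow> q = m)"
proof -
  define A where "A = {q. sublinear q \<and> q \<le> p}"
  have "\<exists>m\<in>A. \<forall>a\<in>A. (\<lambda>f g. g \<le> f) m a \<longrightarrow> a = m"
  proof (rule predicate_Zorn)
    show "partial_order_on A (relation_of (\<lambda>f g. g \<le> f) A)"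
      by (rule partial_order_on_relation_ofI) auto
    fix C assume "C \<in> Chains (relation_of (\<lambda>f g. g \<le> f) A)"
    then have CA: "C \<subseteq> A" and chain: "\<And>f g. f \<in> C \<Longrightarrow> g \<in> C \<Longrightarrow> f \<le> g \<or> g \<le> f"
      by (auto simp: Chains_def relation_of_def)
    show "\<exists>u\<in>A. \<forall>a\<in>C. u \<le> a"
    proof (cases "C = {}")
      case True then show ?thesis using p by (auto simp: A_def)
    next
      case False
      define u where "u x = (INF q\<in>C. q x)" for x
      have lower: "- p (- x) \<le> q x" if "q \<in> C" for q x
      proof -
        have "sublinear q" "q (- x) \<le> p (- x)" using that CA by (auto simp: A_def le_fun_def)
        then show ?thesis using sublinear_minus[of q x] by linarith
      qed
      have u_le: "u x \<le> q x" if "q \<in> C" for q x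
        unfolding u_def by (rule cINF_lower[OF _ that]) (auto intro!: bdd_belowI2 lower)
      have u_ge: "c \<le> u x" if "\<And>q. q \<in> C \<Longrightarrow> c \<le> q x" for c x
        unfolding u_def using False that by (intro cINF_greatest) auto
      have sub: "sublinear q" if "q \<in> C" for q using that CA by (auto simp: A_def)
      have "sublinear u"
      proof (rule sublinearI)
        fix x y
        \<comment> \<open>Of two members of the chain, the smaller one is below both, and its own
          subadditivity gives the estimate.\<close>
        have le: "u (x + y) \<le> f x + g y" if "f \<in> C" "g \<in> C" for f g
          using chain[OF that] that u_le[of f "x + y"] u_le[of g "x + y"]
            sublinear_add[OF sub, of f x y] sublinear_add[OF sub, of g x y]
          by (auto simp: le_fun_def) (smt (verit))+
        have "u (x + y) - f x \<le> u y" if "f \<in> C" for f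
          using le[OF that] by (intro u_ge) (simp add: algebra_simps)
        then have "u (x + y) - u y \<le> u x" by (intro u_ge) (simp add: algebra_simps)
        then show "u (x + y) \<le> u x + u y" by simp
      next
        fix r :: real and x assume r: "0 < r"
        have "u (r *\<^sub>R x) / r \<le> u x"
        proof (rule u_ge)
          fix q assume q: "q \<in> C"
          show "u (r *\<^sub>R x) / r \<le> q x"
            using u_le[OF q, of "r *\<^sub>R x"] sublinear_scale[OF sub[OF q] r] r
            by (simp add: divide_le_eq mult.commute)
        qed
        then show "u (r *\<^sub>R x) \<le> r * u x" using r by (simp add: divide_le_eq mult.commute)
      qed
      moreover have "u \<le> q" if "q \<in> C" for q using u_le[OF that] by (simp add: le_fun_def)
      moreover have "u \<le> p" using False calculation(2) CA by (force simp: A_def)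
      ultimately show ?thesis by (auto simp: A_def)
    qed
  qed
  then obtain m where "m \<in> A" "\<And>a. a \<in> A \<Longrightarrow> a \<le> m \<Longrightarrow> a = m" by auto
  then show ?thesis unfolding A_def by (intro exI[of _ m]) auto
qed

text \<open>A minimal sublinear functional is linear: it cannot be decreased by infimal convolution along
  a ray.\<close>

lemma linear_below_sublinear:
  fixes p :: "'v::real_vector \<Rightarrow> real"
  assumes "sublinear p"
  shows "\<exists>g. linear g \<and> g \<le> p"
proof -
  obtain m where m: "sublinear m" "m \<le> p" and min: "\<And>q. sublinear q \<Longrightarrow> q \<le> m \<Longrightarrow> q = m"
    using minimal_sublinear_exists[OF assms] by auto
  have ge: "m x + m y \<le> m (x + y)" for x y
  proof -
    define q where "q x = (INF t\<in>{0..}. m (x + t *\<^sub>R y) - t * m y)" for x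
    have le: "t * m y \<le> m (t *\<^sub>R y)" if "t \<in> {0..}" for t :: real
      using that sublinear_scale[OF m(1), of t y] sublinear_zero[OF m(1)] by (cases "t = 0") auto
    have l: "linear (\<lambda>t. t *\<^sub>R y)" by (simp add: linear_iff scaleR_add_left)
    note q = sublinear_inf_convolution[of m "{0..}" "\<lambda>t. t *\<^sub>R y" "\<lambda>t. t * m y",
        OF m(1) _ _ _ l _ _ le, folded q_def]
    have "sublinear q" by (rule q(1)) (auto simp: algebra_simps)
    moreover have "q x \<le> m x" for x by (rule q(2)) (auto simp: algebra_simps)
    then have "q \<le> m" by (simp add: le_fun_def)
    ultimately have "q = m" by (rule min)
    moreover have "q x \<le> m (x + 1 *\<^sub>R y) - 1 * m y"
      by (rule q(3)) (auto simp: algebra_simps)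
    ultimately show ?thesis by simp
  qed
  have add: "m (x + y) = m x + m y" for x y
    using ge[of x y] sublinear_add[OF m(1), of x y] by simp
  have neg: "m (- x) = - m x" for x using add[of x "- x"] sublinear_zero[OF m(1)] by simp
  have "m (r *\<^sub>R x) = r * m x" for r x
  proof (cases r "0::real" rule: linorder_cases)
    case less
    then have "m (- ((- r) *\<^sub>R x)) = r * m x"
      unfolding neg using sublinear_scale[OF m(1), of "- r" x] by simp
    then show ?thesis by simp
  qed (use sublinear_scale[OF m(1)] sublinear_zero[OF m(1)] in auto)
  then have "linear m" by (simp add: linear_iff add)
  then show ?thesis using m(2) by blast
qed

text \<open>A linear functional below the infimal convolution \<open>q\<close> is below
  \<open>p\<close>, and its value at \<open>- l m\<close> is at most
  \<open>p 0 - \<phi> m = - \<phi> m\<close>.\<close>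

theorem Hahn_Banach_cone:
  fixes p :: "'v::real_vector \<Rightarrow> real" and M :: "'w::real_vector set"
  assumes p: "sublinear p"
    and M: "0 \<in> M" "\<And>m n. m \<in> M \<Longrightarrow> n \<in> M \<Longrightarrow> m + n \<in> M"
           "\<And>r m. 0 < r \<Longrightarrow> m \<in> M \<Longrightarrow> r *\<^sub>R m \<in> M"
    and l: "linear l"
    and add: "\<And>m n. m \<in> M \<Longrightarrow> n \<in> M \<Longrightarrow> \<phi> m + \<phi> n \<le> \<phi> (m + n)"
    and scale: "\<And>r m. 0 < r \<Longrightarrow> m \<in> M \<Longrightarrow> \<phi> (r *\<^sub>R m) = r * \<phi> m"
    and le: "\<And>m. m \<in> M \<Longrightarrow> \<phi> m \<le> p (l m)"
  obtains g where "linear g" "\<And>x. g x \<le> p x" "\<And>m. m \<in> M \<Longrightarrow> \<phi> m \<le> g (l m)"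
proof -
  define q where "q = (\<lambda>x. INF m\<in>M. p (x + l m) - \<phi> m)"
  have q: "sublinear q" "\<And>x. q x \<le> p x" "\<And>x m. m \<in> M \<Longrightarrow> q x \<le> p (x + l m) - \<phi> m"
    unfolding q_def using sublinear_inf_convolution[of p M l \<phi>] assms by blast+
  obtain g where g: "linear g" "g \<le> q" using linear_below_sublinear[OF q(1)] by blast
  have gq: "g x \<le> q x" for x using g(2) by (simp add: le_fun_def)
  have "\<phi> m \<le> g (l m)" if "m \<in> M" for m
    using gq[of "- l m"] q(3)[OF that, of "- l m"] sublinear_zero[OF p] linear_neg[OF g(1)]
    by simp
  then show ?thesis using that[of g] g(1) gq q(2) order_trans by blast
qed

text \<open>The cone is the ray through \<open>a\<close>, with \<open>t * p a\<close> as the lower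
  bound at \<open>t *\<^sub>R a\<close>.\<close>

corollary Hahn_Banach_point:
  fixes p :: "'v::real_vector \<Rightarrow> real"
  assumes p: "sublinear p"
  obtains g where "linear g" "\<And>x. g x \<le> p x" "g a = p a"
proof -
  have l: "linear (\<lambda>t. t *\<^sub>R a)" by (simp add: linear_iff scaleR_add_left)
  have le: "t * p a \<le> p (t *\<^sub>R a)" if "t \<in> {0..}" for t :: real
    using that sublinear_scale[OF p, of t a] sublinear_zero[OF p] by (cases "t = 0") auto
  obtain g where g: "linear g" "\<And>x. g x \<le> p x" "\<And>t. t \<in> {0..} \<Longrightarrow> t * p a \<le> g (t *\<^sub>R a)"
    by (rule Hahn_Banach_cone[of p "{0..}" "\<lambda>t. t *\<^sub>R a" "\<lambda>t. t * p a"])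
      (use p l le in \<open>auto simp: distrib_right\<close>)
  then show ?thesis using that[of g] g(3)[of 1] g(2)[of a] by auto
qed

text \<open>The cone is the subspace itself; the lower bounds at \<open>m\<close> and
  \<open>- m\<close> together force equality.\<close>

corollary Hahn_Banach_subspace:
  fixes p :: "'v::real_vector \<Rightarrow> real"
  assumes p: "sublinear p" and M: "subspace M" and u: "linear u"
    and le: "\<And>m. m \<in> M \<Longrightarrow> u m \<le> p m"
  obtains g where "linear g" "\<And>x. g x \<le> p x" "\<And>m. m \<in> M \<Longrightarrow> g m = u m"
proof -
  obtain g where g: "linear g" "\<And>x. g x \<le> p x" "\<And>m. m \<in> M \<Longrightarrow> u m \<le> g m"
    by (rule Hahn_Banach_cone[OF p _ _ _ linear_ident _ _ le])
      (auto simp: subspace_0 subspace_add subspace_scale M linear_add[OF u] linear_scale[OF u])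
  have "g m = u m" if "m \<in> M" for m
    using g(3)[OF that] g(3)[OF subspace_neg[OF M that]] linear_neg[OF g(1)] linear_neg[OF u]
    by simp
  then show ?thesis using that g by blast
qed

lemma norming_functional:
  fixes x :: "'v::real_normed_vector"
  obtains f :: "'v \<Rightarrow>\<^sub>L real" where "norm f \<le> 1" "f x = norm x"
proof -
  obtain g where g: "linear g" "\<And>y. g y \<le> 1 * norm y" "g x = 1 * norm x"
    using Hahn_Banach_point[OF sublinear_norm[of 1], of x] by auto
  have abs: "norm (g y) \<le> norm y * 1" for y
    using g(2)[of y] g(2)[of "- y"] linear_neg[OF g(1), of y] by simp
  have bl: "bounded_linear g"
    by (rule bounded_linear_intro[of _ 1]) (use linear_add[OF g(1)] linear_scale[OF g(1)] abs in auto)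
  have "norm (Blinfun g) \<le> 1"
    by (rule norm_blinfun_bound) (use abs in \<open>auto simp: bounded_linear_Blinfun_apply[OF bl]\<close>)
  then show ?thesis using that[of "Blinfun g"] g(3) by (simp add: bounded_linear_Blinfun_apply[OF bl])
qed

subsection \<open>Ultrafilters\<close>

definition ultrafilter :: "'a filter \<Rightarrow> bool"
  where "ultrafilter F \<longleftrightarrow> F \<noteq> bot \<and> (\<forall>P. eventually P F \<or> eventually (\<lambda>x. \<not> P x) F)"

text \<open>Zorn's lemma gives a minimal proper filter below \<open>F0\<close>; the infimum of a
  chain stays proper because its events are those of its members. Minimality decides every
  \<open>P\<close>: either \<open>P\<close> fails eventually, or restricting \<open>F\<close> to
  \<open>P\<close> changes nothing.\<close>

lemma ultrafilter_exists:
  assumes "F0 \<noteq> bot"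
  obtains F where "ultrafilter F" "F \<le> F0"
proof -
  define A where "A = {F. F \<noteq> bot \<and> F \<le> F0}"
  have "\<exists>m\<in>A. \<forall>a\<in>A. (\<lambda>f g. g \<le> f) m a \<longrightarrow> a = m"
  proof (rule predicate_Zorn)
    show "partial_order_on A (relation_of (\<lambda>f g. g \<le> f) A)"
      by (rule partial_order_on_relation_ofI) auto
    fix C assume "C \<in> Chains (relation_of (\<lambda>f g. g \<le> f) A)"
    then have CA: "C \<subseteq> A" and chain: "\<And>f g. f \<in> C \<Longrightarrow> g \<in> C \<Longrightarrow> f \<le> g \<or> g \<le> f"
      by (auto simp: Chains_def relation_of_def)
    show "\<exists>u\<in>A. \<forall>a\<in>C. u \<le> a"
    proof (cases "C = {}")
      case True then show ?thesis using assms by (auto simp: A_def)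
    next
      case False
      have "eventually P (Inf C) \<longleftrightarrow> (\<exists>b\<in>C. eventually P b)" for P
        by (rule eventually_Inf_base[OF False]) (use chain in \<open>force simp: inf_absorb1 inf_absorb2\<close>)
      then have "Inf C \<noteq> bot"
        using CA by (auto simp: trivial_limit_def A_def subset_iff)
      moreover have "Inf C \<le> F0" using False CA by (auto simp: A_def intro: Inf_lower2)
      ultimately show ?thesis by (intro bexI[of _ "Inf C"]) (auto simp: A_def Inf_lower)
    qed
  qed
  then obtain F where F: "F \<noteq> bot" "F \<le> F0" and min: "\<And>G. G \<noteq> bot \<Longrightarrow> G \<le> F \<Longrightarrow> G = F"
    unfolding A_def by (auto intro: order_trans)
  have "eventually P F \<or> eventually (\<lambda>x. \<not> P x) F" for P
  proof (cases "inf F (principal {x. P x}) = bot")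
    case True
    then show ?thesis by (auto simp: trivial_limit_def eventually_inf_principal)
  next
    case False
    then have "inf F (principal {x. P x}) = F" by (intro min) auto
    then have "F \<le> principal {x. P x}" by (metis inf_le2)
    then show ?thesis by (simp add: le_principal)
  qed
  then show ?thesis using that F by (auto simp: ultrafilter_def)
qed

lemma ultrafilter_not_bot: "ultrafilter F \<Longrightarrow> F \<noteq> bot"
  by (simp add: ultrafilter_def)

lemma ultrafilter_finite_union:
  assumes F: "ultrafilter F" and "finite I" "eventually (\<lambda>x. \<exists>i\<in>I. P i x) F"
  shows "\<exists>i\<in>I. eventually (P i) F"
proof (rule ccontr)
  assume "\<not> ?thesis"
  then have "\<forall>i\<in>I. eventually (\<lambda>x. \<not> P i x) F" using F by (auto simp: ultrafilter_def)
  then have "eventually (\<lambda>x. \<forall>i\<in>I. \<not> P i x) F" using assms(2) by (simp add: eventually_ball_finite)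
  with assms(3) have "eventually (\<lambda>x. False) F" by eventually_elim auto
  then show False using F by (auto simp: ultrafilter_def trivial_limit_def)
qed

text \<open>Compactness gives a cluster point of the image filter, and for an ultrafilter a cluster
  point is a limit, since every open set is decided.\<close>

lemma ultrafilter_tendsto_compact:
  fixes f :: "'a \<Rightarrow> 'b::topological_space"
  assumes F: "ultrafilter F" and "compact K" "eventually (\<lambda>x. f x \<in> K) F"
  shows "\<exists>l\<in>K. (f \<longlongrightarrow> l) F"
proof -
  have "filtermap f F \<noteq> bot" using F by (simp add: ultrafilter_def filtermap_bot_iff)
  then obtain l where l: "l \<in> K" "inf (nhds l) (filtermap f F) \<noteq> bot"
    using assms(2,3) by (auto simp: compact_filter eventually_filtermap)
  have "(f \<longlongrightarrow> l) F"
  proof (rule topological_tendstoI)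
    fix S assume S: "open S" "l \<in> S"
    show "eventually (\<lambda>x. f x \<in> S) F"
    proof (rule ccontr)
      assume "\<not> ?thesis"
      then have "eventually (\<lambda>y. y \<notin> S) (filtermap f F)"
        using F by (auto simp: ultrafilter_def eventually_filtermap)
      moreover have "eventually (\<lambda>y. y \<in> S) (nhds l)" using S eventually_nhds by blast
      ultimately have "eventually (\<lambda>_. False) (inf (nhds l) (filtermap f F))"
        unfolding eventually_inf by (intro exI conjI) auto
      then show False using l(2) by (simp add: trivial_limit_def)
    qed
  qed
  then show ?thesis using l(1) by blast
qed

text \<open>If a cover has no finite subcover, the complements in \<open>S\<close> of its finite
  unions generate a proper filter. A finer ultrafilter avoids every member of the cover and so
  cannot converge to a point of \<open>S\<close>.\<close>

lemma compactin_ultrafilterI: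
  assumes "S \<subseteq> topspace X"
    and lim: "\<And>F. ultrafilter F \<Longrightarrow> eventually (\<lambda>y. y \<in> S) F \<Longrightarrow>
           \<exists>x\<in>S. \<forall>U. openin X U \<longrightarrow> x \<in> U \<longrightarrow> eventually (\<lambda>y. y \<in> U) F"
  shows "compactin X S"
  unfolding compactin_def
proof (intro conjI allI impI assms(1))
  fix \<U> assume \<U>: "(\<forall>U\<in>\<U>. openin X U) \<and> S \<subseteq> \<Union>\<U>"
  show "\<exists>\<F>. finite \<F> \<and> \<F> \<subseteq> \<U> \<and> S \<subseteq> \<Union>\<F>"
  proof (rule ccontr)
    assume no: "\<not> ?thesis"
    define F0 where "F0 = (INF \<F>\<in>{\<F>. finite \<F> \<and> \<F> \<subseteq> \<U>}. principal (S - \<Union>\<F>))"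
    have ev: "eventually P F0 \<longleftrightarrow> (\<exists>\<F>\<in>{\<F>. finite \<F> \<and> \<F> \<subseteq> \<U>}. eventually P (principal (S - \<Union>\<F>)))" for P
      unfolding F0_def
    proof (rule eventually_INF_base)
      fix A B assume AB: "A \<in> {\<F>. finite \<F> \<and> \<F> \<subseteq> \<U>}" "B \<in> {\<F>. finite \<F> \<and> \<F> \<subseteq> \<U>}"
      show "\<exists>x\<in>{\<F>. finite \<F> \<and> \<F> \<subseteq> \<U>}. principal (S - \<Union>x) \<le> inf (principal (S - \<Union>A)) (principal (S - \<Union>B))"
        by (rule bexI[of _ "A \<union> B"]) (use AB in auto)
    qed auto
    have "F0 \<noteq> bot"
    proof
      assume "F0 = bot"
      then obtain \<F> where \<F>: "finite \<F>" "\<F> \<subseteq> \<U>" "eventually (\<lambda>_. False) (principal (S - \<Union>\<F>))"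
        using ev[of "\<lambda>_. False"] by auto
      have "S \<subseteq> \<Union>\<F>" using \<F>(3) unfolding eventually_principal by blast
      then show False using no \<F>(1,2) by blast
    qed
    then obtain F where F: "ultrafilter F" "F \<le> F0" by (rule ultrafilter_exists)
    have "{} \<in> {\<F>. finite \<F> \<and> \<F> \<subseteq> \<U>}" by simp
    then have "eventually (\<lambda>y. y \<in> S) F0" unfolding ev by (rule bexI[rotated]) (simp add: eventually_principal)
    then have "eventually (\<lambda>y. y \<in> S) F" by (rule filter_leD[OF F(2)])
    from lim[OF F(1) this] obtain x where x: "x \<in> S"
      "\<forall>U. openin X U \<longrightarrow> x \<in> U \<longrightarrow> eventually (\<lambda>y. y \<in> U) F" by (elim bexE)
    obtain U where U: "U \<in> \<U>" "x \<in> U" using \<U> x(1) by auto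
    have "{U} \<in> {\<F>. finite \<F> \<and> \<F> \<subseteq> \<U>}" using U by simp
    then have "eventually (\<lambda>y. y \<notin> U) F0" unfolding ev by (rule bexI[rotated]) (simp add: eventually_principal)
    then have "eventually (\<lambda>y. y \<notin> U) F" by (rule filter_leD[OF F(2)])
    moreover have "eventually (\<lambda>y. y \<in> U) F" using x(2) U \<U> by blast
    ultimately have "eventually (\<lambda>y. False) F" by eventually_elim auto
    then show False using ultrafilter_not_bot[OF F(1)] by (simp add: trivial_limit_def)
  qed
qed

text \<open>An ultrafilter form of the Banach--Alaoglu theorem. It produces both the element of the
  bidual and the limits of sequences of functionals.\<close>

lemma ultralimit_linear:
  fixes \<phi> :: "'i \<Rightarrow> 'v::real_vector \<Rightarrow> real"
  assumes F: "ultrafilter F"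
    and lin: "\<And>i. linear (\<phi> i)"
    and bd: "\<And>v. eventually (\<lambda>i. \<bar>\<phi> i v\<bar> \<le> B v) F"
  shows "\<exists>L. linear L \<and> (\<forall>v. ((\<lambda>i. \<phi> i v) \<longlongrightarrow> L v) F) \<and> (\<forall>v. \<bar>L v\<bar> \<le> B v)"
proof -
  have "\<exists>l\<in>{- B v..B v}. ((\<lambda>i. \<phi> i v) \<longlongrightarrow> l) F" for v
    by (rule ultrafilter_tendsto_compact[OF F]) (use bd[of v] in \<open>auto elim!: eventually_mono\<close>)
  then obtain L where L: "\<And>v. L v \<in> {- B v..B v}" "\<And>v. ((\<lambda>i. \<phi> i v) \<longlongrightarrow> L v) F" by metis
  note uniq = tendsto_unique[OF ultrafilter_not_bot[OF F]]
  have "L (x + y) = L x + L y" for x y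
    by (rule uniq[OF L(2)]) (use tendsto_add[OF L(2)[of x] L(2)[of y]] in \<open>simp add: linear_add[OF lin]\<close>)
  moreover have "L (r *\<^sub>R x) = r * L x" for r x
    by (rule uniq[OF L(2)]) (use tendsto_mult_left[OF L(2)[of x], of r] in \<open>simp add: linear_scale[OF lin]\<close>)
  ultimately have "linear L" by (simp add: linear_iff)
  then show ?thesis using L by (auto simp: abs_le_iff minus_le_iff)
qed

subsection \<open>Simons' inequality\<close>

text \<open>The weights add up to 1. The induction merges the last two terms: the midpoint of
  \<open>x N\<close> and \<open>a\<close> takes the place of \<open>a\<close>.\<close>

lemma dyadic_average_in_convex:
  fixes x :: "nat \<Rightarrow> 'y::real_vector"
  assumes "convex C" "\<And>m. x m \<in> C" "a \<in> C"
  shows "(\<Sum>m<N. (1/2) ^ Suc m *\<^sub>R x m) + (1/2) ^ N *\<^sub>R a \<in> C"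
  using assms(3)
proof (induction N arbitrary: a)
  case (Suc N)
  have "(1/2) *\<^sub>R x N + (1/2) *\<^sub>R a \<in> C" by (rule convexD[OF assms(1,2) Suc.prems]) auto
  from Suc.IH[OF this] show ?case by (simp add: algebra_simps)
qed simp

lemma summable_dyadic:
  fixes x :: "nat \<Rightarrow> 'y::banach"
  assumes "\<And>m. norm (x m) \<le> 1"
  shows "summable (\<lambda>m. (1/2) ^ Suc m *\<^sub>R x m)"
proof (rule summable_comparison_test)
  show "\<exists>N. \<forall>n\<ge>N. norm ((1/2) ^ Suc n *\<^sub>R x n) \<le> (1/2 :: real) ^ n"
  proof (intro exI allI impI)
    fix n :: nat
    have "norm ((1/2) ^ Suc n *\<^sub>R x n) \<le> (1/2) ^ Suc n * 1"
      using assms[of n] by (simp add: mult_left_mono)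
    also have "\<dots> \<le> (1/2) ^ n" by simp
    finally show "norm ((1/2) ^ Suc n *\<^sub>R x n) \<le> (1/2) ^ n" .
  qed
qed simp

text \<open>Partial sums become convex combinations once the missing weight is put on
  \<open>x 0\<close>; this correction tends to 0.\<close>

lemma dyadic_series_in_closed_convex:
  fixes x :: "nat \<Rightarrow> 'y::banach"
  assumes "convex C" "closed C" "\<And>m. x m \<in> C" "\<And>m. norm (x m) \<le> 1"
  shows "(\<Sum>m. (1/2) ^ Suc m *\<^sub>R x m) \<in> C"
proof (rule closed_sequentially[OF assms(2)])
  show "(\<Sum>m<N. (1/2) ^ Suc m *\<^sub>R x m) + (1/2) ^ N *\<^sub>R x 0 \<in> C" for N
    by (rule dyadic_average_in_convex[OF assms(1,3,3)])
  have "(\<lambda>N. (1/2 :: real) ^ N *\<^sub>R x 0) \<longlonglongrightarrow> 0 *\<^sub>R x 0"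
    by (intro tendsto_scaleR tendsto_const LIMSEQ_power_zero) simp
  from tendsto_add[OF summable_LIMSEQ[OF summable_dyadic[of x, OF assms(4)]] this]
  show "(\<lambda>N. (\<Sum>m<N. (1/2) ^ Suc m *\<^sub>R x m) + (1/2) ^ N *\<^sub>R x 0)
      \<longlonglongrightarrow> (\<Sum>m. (1/2) ^ Suc m *\<^sub>R x m)" by simp
qed

text \<open>The \<open>g n\<close> are chosen greedily, each nearly minimising \<open>S\<close> over
  all completions of the partial sum \<open>h n\<close> by a point of \<open>A n\<close>. This keeps
  \<open>S (h n)\<close> close to at most \<open>(1 - (1/2) ^ n) * S H\<close> for the full sum
  \<open>H\<close>, so a functional \<open>b\<close> below \<open>S\<close> that attains
  \<open>S H\<close> must be large on every tail.\<close>

theorem Simons_inequality: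
  fixes S :: "'y::banach \<Rightarrow> real" and A :: "nat \<Rightarrow> 'y set"
  assumes S: "sublinear S"
    and A: "\<And>n. convex (A n)" "\<And>n. closed (A n)" "\<And>n. A n \<noteq> {}" "decseq A"
    and norm: "\<And>y. y \<in> A 0 \<Longrightarrow> norm y \<le> 1"
    and \<delta>: "0 < \<delta>" "\<And>y. y \<in> A 0 \<Longrightarrow> \<delta> \<le> S y"
  shows "\<exists>g. (\<forall>n. g n \<in> A n) \<and> (\<forall>b n. bounded_linear b \<longrightarrow> (\<forall>y. b y \<le> S y) \<longrightarrow>
      b (\<Sum>m. (1/2) ^ Suc m *\<^sub>R g m) = S (\<Sum>m. (1/2) ^ Suc m *\<^sub>R g m) \<longrightarrow>
      \<delta> / 2 \<le> (\<Sum>m. (1/2) ^ Suc m * b (g (m + n))))"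
proof -
  have A0: "A n \<subseteq> A m" if "m \<le> n" for m n using A(4) that by (simp add: decseq_def)
  \<comment> \<open>A quarter, because the argument loses \<open>2 * \<epsilon>\<close> and
    \<open>\<delta> / 2\<close> has to remain.\<close>
  define \<epsilon> where "\<epsilon> = \<delta> / 4"
  have \<epsilon>: "0 < \<epsilon>" using \<delta>(1) by (simp add: \<epsilon>_def)
  \<comment> \<open>The partial sum \<open>h\<close> has used up the weight
    \<open>1 - (1/2) ^ n\<close>. Every completion lies in \<open>A 0\<close>, where
    \<open>S\<close> is at least \<open>\<delta>\<close>, so the infimum to be approximated
    exists.\<close>
  define P where "P n h \<longleftrightarrow> (n = 0 \<longrightarrow> h = 0) \<and> (\<forall>a\<in>A n. h + (1/2) ^ n *\<^sub>R a \<in> A 0)" for n h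
  \<comment> \<open>The tolerance decays like \<open>(1/4) ^ n\<close> because the accumulated error
    is later divided by \<open>(1/2) ^ n\<close>.\<close>
  define near where "near n h a \<longleftrightarrow> a \<in> A n \<and>
      (\<forall>a'\<in>A n. S (h + (1/2) ^ n *\<^sub>R a) \<le> S (h + (1/2) ^ n *\<^sub>R a') + \<epsilon> * (1/4) ^ n)" for n h a
  have near_ex: "\<exists>a. near n h a" if "P n h" for n h
  proof -
    define I where "I = (INF a\<in>A n. S (h + (1/2) ^ n *\<^sub>R a))"
    have bdd: "bdd_below ((\<lambda>a. S (h + (1/2) ^ n *\<^sub>R a)) ` A n)"
      using that \<delta>(2) by (intro bdd_belowI2[of _ \<delta>]) (auto simp: P_def)
    have "I < I + \<epsilon> * (1/4) ^ n" using \<epsilon> by simp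
    then obtain a where a: "a \<in> A n" "S (h + (1/2) ^ n *\<^sub>R a) < I + \<epsilon> * (1/4) ^ n"
      using cINF_less_iff[OF A(3) bdd, of "I + \<epsilon> * (1/4) ^ n"] unfolding I_def by blast
    moreover have "I \<le> S (h + (1/2) ^ n *\<^sub>R a')" if "a' \<in> A n" for a'
      unfolding I_def by (rule cINF_lower[OF bdd that])
    ultimately have "near n h a" unfolding near_def by fastforce
    then show ?thesis ..
  qed
  have step: "P (Suc n) (h + (1/2) ^ Suc n *\<^sub>R a)" if "P n h" "a \<in> A n" for n h a
    unfolding P_def
  proof (intro conjI ballI)
    fix a' assume "a' \<in> A (Suc n)"
    then have "(1/2) *\<^sub>R a + (1/2) *\<^sub>R a' \<in> A n"
      using A0[of n "Suc n"] that(2) by (intro convexD[OF A(1)]) auto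
    then have "h + (1/2) ^ n *\<^sub>R ((1/2) *\<^sub>R a + (1/2) *\<^sub>R a') \<in> A 0" using that(1) by (simp add: P_def)
    then show "h + (1/2) ^ Suc n *\<^sub>R a + (1/2) ^ Suc n *\<^sub>R a' \<in> A 0" by (simp add: algebra_simps)
  qed simp
  have "\<exists>h. \<forall>n. P n (h n) \<and> (\<exists>a. near n (h n) a \<and> h (Suc n) = h n + (1/2) ^ Suc n *\<^sub>R a)"
  proof (rule dependent_nat_choice)
    show "\<exists>h. P 0 h" by (intro exI[of _ 0]) (simp add: P_def)
    show "\<exists>h'. P (Suc n) h' \<and> (\<exists>a. near n h a \<and> h' = h + (1/2) ^ Suc n *\<^sub>R a)" if "P n h" for h n
      using near_ex[OF that] step[OF that] unfolding near_def by blast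
  qed
  then obtain h where hP: "\<And>n. P n (h n)"
    and "\<forall>n. \<exists>a. near n (h n) a \<and> h (Suc n) = h n + (1/2) ^ Suc n *\<^sub>R a" by blast
  then obtain g where g: "\<And>n. near n (h n) (g n)" "\<And>n. h (Suc n) = h n + (1/2) ^ Suc n *\<^sub>R g n"
    by metis
  have gA: "g n \<in> A n" for n using g(1)[of n] by (simp add: near_def)
  have gA': "g (m + n) \<in> A n" for m n using gA A0[of n "m + n"] by auto
  have g1: "norm (g n) \<le> 1" for n using gA'[of n 0] norm by simp
  have h_sum: "h n = (\<Sum>m<n. (1/2) ^ Suc m *\<^sub>R g m)" for n
    by (induction n) (use hP[of 0] in \<open>simp_all add: P_def g(2)\<close>)
  define H where "H = (\<Sum>m. (1/2) ^ Suc m *\<^sub>R g m)"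
  define tail where "tail n = (\<Sum>m. (1/2) ^ Suc m *\<^sub>R g (m + n))" for n
  have tailA: "tail n \<in> A n" for n
    unfolding tail_def by (rule dyadic_series_in_closed_convex) (use A gA' g1 in auto)
  have H_split: "H = h n + (1/2) ^ n *\<^sub>R tail n" for n
  proof -
    have "(\<Sum>m. (1/2) ^ Suc (m + n) *\<^sub>R g (m + n)) = (\<Sum>m. (1/2) ^ n *\<^sub>R ((1/2) ^ Suc m *\<^sub>R g (m + n)))"
      by (simp add: power_add mult_ac)
    also have "\<dots> = (1/2) ^ n *\<^sub>R tail n"
      unfolding tail_def by (rule suminf_scaleR_right[symmetric]) (rule summable_dyadic, rule g1)
    finally show ?thesis
      unfolding H_def using suminf_split_initial_segment[OF summable_dyadic[of g, OF g1], of n]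
      by (simp add: h_sum)
  qed
  \<comment> \<open>The normalised tail lies in \<open>A n\<close>, hence competes with
    \<open>g n\<close> in the minimisation, and completing \<open>h n\<close> by it gives
    \<open>H\<close>.\<close>
  have near_H: "S (h n + (1/2) ^ n *\<^sub>R g n) \<le> S H + \<epsilon> * (1/4) ^ n" for n
  proof -
    have "S (h n + (1/2) ^ n *\<^sub>R g n) \<le> S (h n + (1/2) ^ n *\<^sub>R tail n) + \<epsilon> * (1/4) ^ n"
      using g(1)[of n] tailA[of n] unfolding near_def by blast
    then show ?thesis using H_split[of n] by simp
  qed
  \<comment> \<open>\<open>h (Suc n)\<close> is the midpoint of \<open>h n\<close> and
    \<open>h n + (1/2) ^ n *\<^sub>R g n\<close>. The error factor solves
    \<open>e (n + 1) = e n / 2 + (1/4) ^ n / 2\<close> with \<open>e 0 = 0\<close>.\<close>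
  have bound: "S (h n) \<le> (1 - (1/2) ^ n) * S H + \<epsilon> * (2 * (1/2) ^ n - 2 * (1/4) ^ n)" for n
  proof (induction n)
    case 0
    show ?case using hP[of 0] sublinear_zero[OF S] by (simp add: P_def)
  next
    case (Suc n)
    have "h (Suc n) = (1/2) *\<^sub>R h n + (1/2) *\<^sub>R (h n + (1/2) ^ n *\<^sub>R g n)"
      unfolding g(2) by (simp add: algebra_simps flip: scaleR_add_left)
    then have "S (h (Suc n)) \<le> S ((1/2) *\<^sub>R h n) + S ((1/2) *\<^sub>R (h n + (1/2) ^ n *\<^sub>R g n))"
      by (simp only: sublinear_add[OF S])
    also have "\<dots> = 1/2 * S (h n) + 1/2 * S (h n + (1/2) ^ n *\<^sub>R g n)"
      by (subst (1 2) sublinear_scale[OF S]) simp_all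
    also have "\<dots> \<le> 1/2 * ((1 - (1/2) ^ n) * S H + \<epsilon> * (2 * (1/2) ^ n - 2 * (1/4) ^ n))
        + 1/2 * (S H + \<epsilon> * (1/4) ^ n)"
      by (intro add_mono mult_left_mono Suc.IH near_H) simp_all
    also have "\<dots> = (1 - (1/2) ^ Suc n) * S H + \<epsilon> * (2 * (1/2) ^ Suc n - 2 * (1/4) ^ Suc n)"
      by (simp add: field_simps)
    finally show ?case .
  qed
  have HA: "H \<in> A 0" using tailA[of 0] H_split[of 0] hP[of 0] by (simp add: P_def)
  have "\<delta> / 2 \<le> (\<Sum>m. (1/2) ^ Suc m * b (g (m + n)))"
    if b: "bounded_linear b" "\<And>y. b y \<le> S y" "b H = S H" for b n
  proof -
    interpret b: bounded_linear b by (rule b(1))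
    have "b H = b (h n) + (1/2) ^ n * b (tail n)"
      by (subst H_split[of n]) (simp add: b.add b.scaleR)
    then have "S H \<le> S (h n) + (1/2) ^ n * b (tail n)" using b(2)[of "h n"] b(3) by linarith
    moreover have "0 \<le> \<epsilon> * (1/4) ^ n" using \<epsilon> by simp
    ultimately have "(1/2) ^ n * (S H - 2 * \<epsilon>) \<le> (1/2) ^ n * b (tail n)"
      using bound[of n] by (simp add: algebra_simps)
    then have "S H - 2 * \<epsilon> \<le> b (tail n)" by (subst (asm) mult_le_cancel_left_pos) auto
    then have "\<delta> / 2 \<le> b (tail n)" using \<delta>(2)[OF HA] by (simp add: \<epsilon>_def)
    also have "b (tail n) = (\<Sum>m. b ((1/2) ^ Suc m *\<^sub>R g (m + n)))"
      unfolding tail_def by (rule b.suminf) (rule summable_dyadic, rule g1)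
    finally show ?thesis by (simp add: b.scaleR)
  qed
  then show ?thesis using gA unfolding H_def by blast
qed

subsection \<open>Functionals on the dual space\<close>

lemma bounded_linear_of_bound:
  fixes u :: "'f::real_normed_vector \<Rightarrow> real"
  assumes "linear u" "\<And>x. \<bar>u x\<bar> \<le> B * norm x"
  shows "bounded_linear u"
  by (rule bounded_linear_intro[of _ B])
    (use linear_add[OF assms(1)] linear_scale[OF assms(1)] assms(2) in \<open>auto simp: mult.commute\<close>)

text \<open>Induction on \<open>G\<close>: a suitable multiple of evaluation at \<open>a\<close> is
  subtracted, found from a functional \<open>f0\<close> that vanishes on \<open>G\<close> but not at
  \<open>a\<close>. If there is no such \<open>f0\<close>, the point \<open>a\<close> adds no
  condition.\<close>

lemma functional_vanishing_on_annihilator: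
  fixes u :: "('f::real_normed_vector \<Rightarrow>\<^sub>L real) \<Rightarrow> real"
  assumes "finite G" "linear u" "\<And>f. (\<forall>x\<in>G. blinfun_apply f x = 0) \<Longrightarrow> u f = 0"
  shows "\<exists>x. \<forall>f. u f = blinfun_apply f x"
  using assms
proof (induction G arbitrary: u)
  case empty
  then show ?case by (intro exI[of _ 0]) simp
next
  case (insert a G)
  show ?case
  proof (cases "\<exists>f0 :: 'f \<Rightarrow>\<^sub>L real. (\<forall>x\<in>G. blinfun_apply f0 x = 0) \<and> blinfun_apply f0 a \<noteq> 0")
    case False
    then have "blinfun_apply f a = 0" if "\<forall>x\<in>G. blinfun_apply f x = 0" for f :: "'f \<Rightarrow>\<^sub>L real"
      using that by blast
    then have "\<forall>x\<in>insert a G. blinfun_apply f x = 0" if "\<forall>x\<in>G. blinfun_apply f x = 0" for f :: "'f \<Rightarrow>\<^sub>L real"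
      using that by blast
    then show ?thesis using insert.IH[OF insert.prems(1)] insert.prems(2) by blast
  next
    case True
    then obtain f0 :: "'f \<Rightarrow>\<^sub>L real" where f0: "\<forall>x\<in>G. blinfun_apply f0 x = 0" "blinfun_apply f0 a \<noteq> 0" by blast
    define c where "c = u f0 / blinfun_apply f0 a"
    have "\<exists>x. \<forall>f. u f - c * blinfun_apply f a = blinfun_apply f x"
    proof (rule insert.IH)
      show "linear (\<lambda>f. u f - c * blinfun_apply f a)"
        using insert.prems(1) by (simp add: linear_iff blinfun.add_left blinfun.scaleR_left algebra_simps)
      fix f :: "'f \<Rightarrow>\<^sub>L real" assume f: "\<forall>x\<in>G. blinfun_apply f x = 0"
      have "u (f - (f a / f0 a) *\<^sub>R f0) = 0"
        by (rule insert.prems(2)) (use f f0 in \<open>auto simp: blinfun.diff_left blinfun.scaleR_left\<close>)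
      then show "u f - c * blinfun_apply f a = 0"
        by (simp add: linear_diff[OF insert.prems(1)] linear_scale[OF insert.prems(1)] c_def)
    qed
    then obtain x where x: "\<And>f. u f - c * blinfun_apply f a = blinfun_apply f x" by blast
    have "u f = blinfun_apply f (x + c *\<^sub>R a)" for f
      using x[of f] by (simp add: blinfun.add_right blinfun.scaleR_right algebra_simps)
    then show ?thesis by blast
  qed
qed

text \<open>Otherwise \<open>z\<close> is bounded by \<open>d\<close> times the norm on the
  annihilator of \<open>G\<close>. Extend this restriction to \<open>w\<close> with the same bound;
  then \<open>z - w\<close> vanishes on the annihilator, hence is evaluation at a point, and
  \<open>z\<close> is within \<open>d\<close> of that point.\<close>

lemma Helly_annihilator:
  fixes z :: "('f::real_normed_vector \<Rightarrow>\<^sub>L real) \<Rightarrow> real"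
  assumes z: "linear z" and d: "0 < d" and G: "finite G"
    and far: "\<And>x. \<exists>f. d * norm f < \<bar>z f - blinfun_apply f x\<bar>"
  obtains f where "norm f = 1" "\<And>x. x \<in> G \<Longrightarrow> blinfun_apply f x = 0" "d < z f"
proof -
  define N where "N = {f :: 'f \<Rightarrow>\<^sub>L real. \<forall>x\<in>G. blinfun_apply f x = 0}"
  have N: "subspace N"
    by (auto simp: subspace_def N_def blinfun.add_left blinfun.scaleR_left)
  have "\<exists>f\<in>N. d * norm f < z f"
  proof (rule ccontr)
    assume "\<not> ?thesis"
    then have le: "z f \<le> d * norm f" if "f \<in> N" for f using that by force
    have sub: "sublinear (\<lambda>f :: 'f \<Rightarrow>\<^sub>L real. d * norm f)" using d by (intro sublinear_norm) simp
    obtain w where w: "linear w" "\<And>f. w f \<le> d * norm f" "\<And>f. f \<in> N \<Longrightarrow> w f = z f"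
      by (rule Hahn_Banach_subspace[OF sub N z le]) auto
    have "\<exists>x. \<forall>f. (z f - w f) = blinfun_apply f x"
      by (rule functional_vanishing_on_annihilator[OF G])
        (use w(3) linear_compose_sub[OF z w(1)] in \<open>auto simp: N_def\<close>)
    then obtain x where x: "\<And>f. z f - w f = blinfun_apply f x" by blast
    have "\<bar>z f - blinfun_apply f x\<bar> \<le> d * norm f" for f
      using x[of f] w(2)[of f] w(2)[of "- f"] linear_neg[OF w(1), of f] by simp
    then show False using far[of x] by (meson not_le)
  qed
  then obtain f where f: "f \<in> N" "d * norm f < z f" by blast
  have nz: "f \<noteq> 0" using f(2) linear_0[OF z] by auto
  show ?thesis
  proof (rule that[of "inverse (norm f) *\<^sub>R f"])
    show "d < z (inverse (norm f) *\<^sub>R f)"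
      using f(2) nz by (simp add: linear_scale[OF z] field_simps)
    show "blinfun_apply (inverse (norm f) *\<^sub>R f) x = 0" if "x \<in> G" for x
      using f(1) that by (simp add: N_def blinfun.scaleR_left)
  qed (use nz in simp)
qed

subsection \<open>Locally convex topologies\<close>

lemma closure_of_meets: "y \<in> X closure_of A \<Longrightarrow> openin X U \<Longrightarrow> y \<in> U \<Longrightarrow> \<exists>w\<in>A. w \<in> U"
  by (auto simp: in_closure_of)

text \<open>Only real scalars occur here, since convexity and separation are real notions.\<close>

locale lc_topology =
  fixes \<T> :: "'f::real_normed_vector topology"
  assumes topspace_UNIV [simp]: "topspace \<T> = UNIV"
    and continuous_add: "continuous_map (prod_topology \<T> \<T>) \<T> (\<lambda>(x, y). x + y)"
    and continuous_scale: "continuous_map (prod_topology euclideanreal \<T>) \<T> (\<lambda>(r, x). r *\<^sub>R x)"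
    and convex_base: "\<And>U. openin \<T> U \<Longrightarrow> 0 \<in> U \<Longrightarrow> \<exists>V. openin \<T> V \<and> 0 \<in> V \<and> V \<subseteq> U \<and> convex V"
begin

lemma continuous_map_add_scale:
  assumes "continuous_map Y euclideanreal r" "continuous_map Y \<T> f" "continuous_map Y \<T> g"
  shows "continuous_map Y \<T> (\<lambda>y. f y + r y *\<^sub>R g y)"
proof -
  have "continuous_map Y \<T> (\<lambda>y. r y *\<^sub>R g y)"
    using continuous_map_compose[OF continuous_map_pairedI[OF assms(1,3)] continuous_scale]
    by (simp add: o_def)
  from continuous_map_compose[OF continuous_map_pairedI[OF assms(2) this] continuous_add]
  show ?thesis by (simp add: o_def)
qed

lemma continuous_affine: "continuous_map \<T> \<T> (\<lambda>x. a + r *\<^sub>R x)"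
  by (rule continuous_map_add_scale) (use continuous_map_id in \<open>auto simp: id_def\<close>)

lemma openin_affine: "openin \<T> U \<Longrightarrow> openin \<T> {x. a + r *\<^sub>R x \<in> U}"
  using openin_continuous_map_preimage[OF continuous_affine[of a r], of U] by simp

text \<open>A convex neighbourhood is intersected with its negative. The factor \<open>c\<close>
  leaves room for sums of several elements of \<open>V\<close>.\<close>

lemma symmetric_convex_neighbourhood:
  assumes "openin \<T> U" "x \<in> U"
  obtains V where "openin \<T> V" "convex V" "0 \<in> V" "\<And>v. v \<in> V \<Longrightarrow> - v \<in> V"
    "\<And>v. v \<in> V \<Longrightarrow> x + c *\<^sub>R v \<in> U"
proof -
  obtain W where W: "openin \<T> W" "0 \<in> W" "W \<subseteq> {v. x + c *\<^sub>R v \<in> U}" "convex W"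
    using convex_base[OF openin_affine[OF assms(1), of x c]] assms(2) by auto
  define V where "V = W \<inter> {x. 0 + (-1) *\<^sub>R x \<in> W}"
  have "{x. 0 + (-1) *\<^sub>R x \<in> W} = uminus ` W" by force
  then have "convex V" unfolding V_def using W(4) by (simp add: convex_Int convex_negations)
  then show ?thesis
    by (rule that[rotated]) (use W openin_affine[OF W(1), of 0 "-1"] in \<open>auto simp: V_def\<close>)
qed

lemma absorbing:
  assumes "openin \<T> V" "0 \<in> V"
  obtains r where "0 < r" "r *\<^sub>R x \<in> V"
proof -
  have "continuous_map euclideanreal \<T> (\<lambda>r. 0 + r *\<^sub>R x)"
    by (rule continuous_map_add_scale) simp_all
  then have "open {r. r *\<^sub>R x \<in> V}"
    using openin_continuous_map_preimage[OF _ assms(1), of euclideanreal "\<lambda>r. 0 + r *\<^sub>R x"] by simp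
  then obtain e where e: "0 < e" "ball 0 e \<subseteq> {r. r *\<^sub>R x \<in> V}"
    using assms(2) unfolding open_contains_ball by (metis mem_Collect_eq scaleR_zero_left)
  have "e / 2 \<in> ball 0 e" using e(1) by simp
  from subsetD[OF e(2) this] have "(e / 2) *\<^sub>R x \<in> V" by simp
  then show ?thesis using that e(1) by (meson half_gt_zero)
qed

text \<open>An upper bound on a symmetric neighbourhood of 0 bounds the absolute value, and scaling
  that neighbourhood gives continuity everywhere.\<close>

lemma continuous_linear_functional:
  fixes g :: "'f \<Rightarrow> real"
  assumes g: "linear g" and V: "openin \<T> V" "0 \<in> V" and le: "\<And>v. v \<in> V \<Longrightarrow> g v \<le> 1"
  shows "continuous_map \<T> euclideanreal g"
proof -
  obtain W where W: "openin \<T> W" "0 \<in> W" "\<And>v. v \<in> W \<Longrightarrow> - v \<in> W" "\<And>v. v \<in> W \<Longrightarrow> v \<in> V"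
    by (rule symmetric_convex_neighbourhood[OF V, of 1]) auto
  have abs: "\<bar>g v\<bar> \<le> 1" if "v \<in> W" for v
    using le[OF W(4)[OF that]] le[OF W(4)[OF W(3)[OF that]]] linear_neg[OF g, of v] by auto
  have "openin \<T> {x. g x \<in> U}" if U: "open U" for U
  proof (subst openin_subopen, intro ballI)
    fix x assume "x \<in> {x. g x \<in> U}"
    then obtain e where e: "0 < e" "ball (g x) e \<subseteq> U" using U by (auto simp: open_contains_ball)
    define N where "N = {y. - (2 / e) *\<^sub>R x + (2 / e) *\<^sub>R y \<in> W}"
    have "N \<subseteq> {x. g x \<in> U}"
    proof
      fix y assume "y \<in> N"
      then have "\<bar>g (- (2 / e) *\<^sub>R x + (2 / e) *\<^sub>R y)\<bar> \<le> 1" by (intro abs) (simp add: N_def)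
      also have "g (- (2 / e) *\<^sub>R x + (2 / e) *\<^sub>R y) = (2 / e) * (g y - g x)"
        unfolding linear_add[OF g] linear_scale[OF g] by (simp add: right_diff_distrib)
      finally have "\<bar>g y - g x\<bar> < e" using e(1) by (simp add: abs_mult field_simps)
      then show "y \<in> {x. g x \<in> U}" using e(2) by (auto simp: dist_real_def subset_iff)
    qed
    moreover have "openin \<T> N" unfolding N_def by (rule openin_affine[OF W(1)])
    moreover have "x \<in> N" using W(2) by (simp add: N_def)
    ultimately show "\<exists>T. openin \<T> T \<and> x \<in> T \<and> T \<subseteq> {x. g x \<in> U}" by blast
  qed
  then show ?thesis by (auto simp: continuous_map_def)
qed

text \<open>Hahn--Banach at the point \<open>a\<close> for the Minkowski gauge \<open>p\<close> of
  \<open>V\<close>, which is at most 1 on \<open>V\<close> and at least 1 at \<open>a\<close>.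
  Continuity follows from the bound on \<open>V\<close>.\<close>

lemma separation:
  assumes V: "openin \<T> V" "convex V" "0 \<in> V" and a: "a \<notin> V"
  obtains g where "linear g" "continuous_map \<T> euclideanreal g" "\<And>v. v \<in> V \<Longrightarrow> g v \<le> (1::real)" "1 \<le> g a"
proof -
  define R where "R x = {r. 0 < r \<and> inverse r *\<^sub>R x \<in> V}" for x
  define p where "p x = Inf (R x)" for x
  have R_nonempty: "R x \<noteq> {}" for x
  proof -
    obtain r where "0 < r" "r *\<^sub>R x \<in> V" by (rule absorbing[OF V(1,3)])
    then have "inverse r \<in> R x" by (simp add: R_def)
    then show ?thesis by blast
  qed
  have p_le: "p x \<le> r" if "r \<in> R x" for r x
    unfolding p_def by (rule cInf_lower[OF that]) (auto simp: R_def intro!: bdd_belowI[of _ 0])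
  have p_ge: "c \<le> p x" if "\<And>r. r \<in> R x \<Longrightarrow> c \<le> r" for c x
    unfolding p_def using that R_nonempty by (intro cInf_greatest)
  have p: "sublinear p"
  proof (rule sublinearI)
    fix x y
    have "r + s \<in> R (x + y)" if "r \<in> R x" "s \<in> R y" for r s
    proof -
      have rs: "0 < r" "0 < s" using that by (auto simp: R_def)
      have "(r / (r + s)) *\<^sub>R (inverse r *\<^sub>R x) + (s / (r + s)) *\<^sub>R (inverse s *\<^sub>R y) \<in> V"
        using that rs by (intro convexD[OF V(2)]) (auto simp: R_def add_divide_distrib[symmetric])
      then show ?thesis using rs by (simp add: R_def scaleR_add_right field_simps)
    qed
    then have "p (x + y) - r \<le> s" if "r \<in> R x" "s \<in> R y" for r s
      using p_le[of "r + s" "x + y"] that by fastforce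
    then have "p (x + y) - r \<le> p y" if "r \<in> R x" for r
      using that by (intro p_ge) blast
    then have "p (x + y) - p y \<le> p x" by (intro p_ge) (simp add: algebra_simps)
    then show "p (x + y) \<le> p x + p y" by simp
  next
    fix r :: real and x assume r: "0 < r"
    have "p (r *\<^sub>R x) / r \<le> p x"
    proof (rule p_ge)
      fix s assume "s \<in> R x"
      then have "r * s \<in> R (r *\<^sub>R x)" using r by (simp add: R_def field_simps)
      from p_le[OF this] show "p (r *\<^sub>R x) / r \<le> s" using r by (simp add: field_simps)
    qed
    then show "p (r *\<^sub>R x) \<le> r * p x" using r by (simp add: field_simps)
  qed
  have pa: "1 \<le> p a"
  proof (rule p_ge, rule ccontr)
    fix r assume r: "r \<in> R a" "\<not> 1 \<le> r"
    then have "r *\<^sub>R (inverse r *\<^sub>R a) + (1 - r) *\<^sub>R 0 \<in> V"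
      by (intro convexD[OF V(2)]) (auto simp: R_def V(3))
    then show False using a r by (simp add: R_def)
  qed
  have p1: "p v \<le> 1" if "v \<in> V" for v using that by (intro p_le) (simp add: R_def)
  obtain g where g: "linear g" "\<And>x. g x \<le> p x" "g a = p a"
    using Hahn_Banach_point[OF p, where a = a] by blast
  have le: "g v \<le> 1" if "v \<in> V" for v using p1[OF that] g(2)[of v] by simp
  have "continuous_map \<T> euclideanreal g"
    by (rule continuous_linear_functional[OF g(1) V(1,3) le])
  from that[OF g(1) this le] pa show ?thesis by (simp add: g(3))
qed

text \<open>Adding a point \<open>a\<close> to a nonempty \<open>G\<close> makes the hull the union
  of the segments from \<open>a\<close> to the old hull, a continuous image of
  \<open>{0..1} \<times> (convex hull G)\<close>.\<close>

lemma compactin_convex_hull_finite: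
  assumes "finite G"
  shows "compactin \<T> (convex hull G)"
  using assms
proof induction
  case (insert a G)
  show ?case
  proof (cases "G = {}")
    case False
    have cont: "continuous_map (prod_topology euclideanreal \<T>) \<T> (\<lambda>p. (1 - fst p) *\<^sub>R a + fst p *\<^sub>R snd p)"
    proof (rule continuous_map_add_scale[OF continuous_map_fst _ continuous_map_snd])
      have "continuous_map (prod_topology euclideanreal \<T>) euclideanreal (\<lambda>p. - fst p)"
        by (rule continuous_map_minus[OF continuous_map_fst])
      from continuous_map_add_scale[OF this, of "\<lambda>_. a" "\<lambda>_. a"]
      show "continuous_map (prod_topology euclideanreal \<T>) \<T> (\<lambda>p. (1 - fst p) *\<^sub>R a)"
        by (simp add: scaleR_diff_left)
    qed
    have comp: "compactin (prod_topology euclideanreal \<T>) ({0..1} \<times> (convex hull G))"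
      using insert.IH by (simp add: compactin_Times)
    have eq: "convex hull (insert a G) =
        (\<lambda>p. (1 - fst p) *\<^sub>R a + fst p *\<^sub>R snd p) ` ({0..1} \<times> (convex hull G))"
      using False by (force simp: convex_hull_insert_alt)
    show ?thesis unfolding eq by (rule image_compactin[OF comp cont])
  qed simp
qed simp

lemma compactin_finite_translates:
  assumes K: "compactin \<T> K" and V: "openin \<T> V" "0 \<in> V"
  obtains G where "finite G" "G \<subseteq> K" "\<And>y. y \<in> K \<Longrightarrow> \<exists>k\<in>G. y - k \<in> V"
proof -
  define U where "U k = {y. - k + 1 *\<^sub>R y \<in> V}" for k
  have "\<exists>\<F>. finite \<F> \<and> \<F> \<subseteq> U ` K \<and> K \<subseteq> \<Union>\<F>"
  proof (rule compactinD[OF K])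
    show "openin \<T> W" if "W \<in> U ` K" for W
      using that openin_affine[OF V(1)] by (auto simp only: U_def)
    show "K \<subseteq> \<Union>(U ` K)" using V(2) by (auto simp: U_def)
  qed
  then obtain \<F> where \<F>: "finite \<F>" "\<F> \<subseteq> U ` K" "K \<subseteq> \<Union>\<F>" by blast
  from finite_subset_image[OF \<F>(1,2)] obtain G where G: "G \<subseteq> K" "finite G" "\<F> = U ` G" by blast
  have "\<exists>k\<in>G. y - k \<in> V" if "y \<in> K" for y
    using subsetD[OF \<F>(3) that] unfolding G(3) by (simp add: U_def)
  then show ?thesis using that G by blast
qed

text \<open>A finite net \<open>G0\<close> for the closure of \<open>S\<close> puts
  \<open>convex hull S\<close> into \<open>convex hull G0 + V\<close>, and the compact hull of
  \<open>G0\<close> has a finite net \<open>G\<close>. These two approximations and the passage to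
  the closure cost one copy of \<open>V\<close> each.\<close>

lemma closure_convex_hull_totally_bounded:
  assumes K: "compactin \<T> (\<T> closure_of S)" and V: "openin \<T> V" "0 \<in> V" "convex V" "\<And>v. v \<in> V \<Longrightarrow> - v \<in> V"
  obtains G where "finite G" "\<And>y. y \<in> \<T> closure_of (convex hull S) \<Longrightarrow> \<exists>k\<in>G. \<exists>v\<in>V. y = k + 3 *\<^sub>R v"
proof -
  obtain G0 where G0: "finite G0" "\<And>y. y \<in> \<T> closure_of S \<Longrightarrow> \<exists>k\<in>G0. y - k \<in> V"
    by (rule compactin_finite_translates[OF K V(1,2)]) auto
  obtain G where G: "finite G" "\<And>y. y \<in> convex hull G0 \<Longrightarrow> \<exists>k\<in>G. y - k \<in> V"
    by (rule compactin_finite_translates[OF compactin_convex_hull_finite[OF G0(1)] V(1,2)]) auto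
  have "S \<subseteq> (\<Union>x\<in>convex hull G0. \<Union>v\<in>V. {x + v})"
  proof
    fix y assume "y \<in> S"
    then have "y \<in> \<T> closure_of S" using closure_of_subset[of S \<T>] by auto
    then obtain k where k: "k \<in> G0" "y - k \<in> V" using G0(2) by blast
    then have "k \<in> convex hull G0" "y = k + (y - k)" by (auto simp: hull_inc)
    then show "y \<in> (\<Union>x\<in>convex hull G0. \<Union>v\<in>V. {x + v})" using k(2) by (intro UN_I) auto
  qed
  moreover have "convex (\<Union>x\<in>convex hull G0. \<Union>v\<in>V. {x + v})"
    by (rule convex_sums[OF convex_convex_hull V(3)])
  ultimately have hull: "convex hull S \<subseteq> (\<Union>x\<in>convex hull G0. \<Union>v\<in>V. {x + v})"
    by (rule hull_minimal)
  have "\<exists>k\<in>G. \<exists>v\<in>V. y = k + 3 *\<^sub>R v" if y: "y \<in> \<T> closure_of (convex hull S)" for y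
  proof -
    have "openin \<T> {w. - y + 1 *\<^sub>R w \<in> V}" by (rule openin_affine[OF V(1)])
    from closure_of_meets[OF y this] V(2)
    obtain w where w: "w \<in> convex hull S" and w2: "w - y \<in> V" by auto
    obtain x v where xv: "x \<in> convex hull G0" "v \<in> V" "w = x + v" using subsetD[OF hull w] by auto
    obtain k where k: "k \<in> G" "x - k \<in> V" using G(2)[OF xv(1)] by blast
    \<comment> \<open>The average, with weight 1/3 each, of the three errors \<open>x - k\<close>,
      \<open>v\<close> and \<open>- (w - y)\<close>.\<close>
    define a where "a = (1/3) *\<^sub>R (x - k) + (2/3) *\<^sub>R ((1/2) *\<^sub>R v + (1/2) *\<^sub>R (- (w - y)))"
    have "a \<in> V" unfolding a_def
      by (intro convexD[OF V(3)] k(2) xv(2) V(4) w2) auto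
    moreover have "y = k + 3 *\<^sub>R a" by (simp add: a_def xv(3) algebra_simps)
    ultimately show ?thesis using k(1) by blast
  qed
  then show ?thesis using that G(1) by blast
qed

end

subsection \<open>Krein's theorem\<close>

lemma convex_hull_finite_subset:
  fixes S :: "'v::real_vector set"
  assumes "y \<in> convex hull S"
  obtains G where "finite G" "G \<subseteq> S" "y \<in> convex hull G"
proof -
  obtain G u where G: "finite G" "G \<subseteq> S" "\<forall>x\<in>G. 0 \<le> u x" "sum u G = 1" "(\<Sum>v\<in>G. u v *\<^sub>R v) = y"
    using assms unfolding convex_hull_explicit by blast
  then have "y \<in> convex hull G" by (auto simp: convex_hull_finite)
  then show ?thesis using that G(1,2) by blast
qed

lemma linear_blinfun_apply: "linear (blinfun_apply f)"
  by (rule bounded_linear.linear[OF blinfun.bounded_linear_right])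

text \<open>The real form of compatibility: the \<open>\<T>\<close>-continuous real functionals are
  exactly the elements of the norm dual.\<close>

locale norm_compatible_topology = lc_topology \<T> for \<T> :: "'f::banach topology" +
  assumes continuous_iff_bounded:
    "\<And>g :: 'f \<Rightarrow> real. linear g \<Longrightarrow> continuous_map \<T> euclideanreal g \<longleftrightarrow> bounded_linear g"
begin

section \<open>Bounds on functionals and norms under \<open>\<T>\<close>-closure\<close>

lemma continuous_blinfun: "continuous_map \<T> euclideanreal (blinfun_apply f)"
  using continuous_iff_bounded[OF linear_blinfun_apply] blinfun.bounded_linear_right by simp

lemma functional_le_closure:
  fixes f :: "'f \<Rightarrow>\<^sub>L real"
  assumes y: "y \<in> \<T> closure_of A" and le: "\<And>x. x \<in> A \<Longrightarrow> f x \<le> c"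
  shows "f y \<le> c"
proof -
  have "closedin \<T> {x \<in> topspace \<T>. f x \<in> {..c}}"
    by (rule closedin_continuous_map_preimage[OF continuous_blinfun]) simp
  then have "\<T> closure_of A \<subseteq> {x \<in> topspace \<T>. f x \<in> {..c}}"
    using le by (intro closure_of_minimal) auto
  then show ?thesis using y by auto
qed

lemma functional_le_hull:
  fixes f :: "'f \<Rightarrow>\<^sub>L real"
  assumes y: "y \<in> convex hull A" and le: "\<And>x. x \<in> A \<Longrightarrow> f x \<le> c"
  shows "f y \<le> c"
proof -
  have "convex {x. f x \<le> c}"
    using convex_linear_vimage[of "blinfun_apply f" "{..c}"]
    by (simp add: linear_blinfun_apply vimage_def)
  then have "convex hull A \<subseteq> {x. f x \<le> c}" using le by (intro hull_minimal) auto
  then show ?thesis using y by auto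
qed

lemma functional_eq_closure:
  fixes f :: "'f \<Rightarrow>\<^sub>L real"
  assumes y: "y \<in> \<T> closure_of A" and 0: "\<And>x. x \<in> A \<Longrightarrow> f x = 0"
  shows "f y = 0"
  using functional_le_closure[OF y, of f 0] functional_le_closure[OF y, of "- f" 0] 0
  by (force simp: blinfun.minus_left)

text \<open>A norming functional at \<open>y\<close> is \<open>\<T>\<close>-continuous, so its bound
  on \<open>S\<close> passes to the hull and to the \<open>\<T>\<close>-closure.\<close>

lemma norm_le_hull_closure:
  assumes y: "y \<in> \<T> closure_of (convex hull S)" and le: "\<And>x. x \<in> S \<Longrightarrow> norm x \<le> B"
  shows "norm y \<le> B"
proof -
  obtain f :: "'f \<Rightarrow>\<^sub>L real" where f: "norm f \<le> 1" "f y = norm y" by (rule norming_functional)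
  have "f x \<le> B" if "x \<in> S" for x
    using norm_blinfun[of f x] le[OF that] mult_left_le_one_le[OF norm_ge_zero[of x] norm_ge_zero f(1)]
    by simp
  then have "f x \<le> B" if "x \<in> convex hull S" for x using that by (rule functional_le_hull[rotated])
  then show ?thesis using functional_le_closure[OF y, of f B] f(2) by simp
qed

text \<open>If \<open>\<bar>g m x0\<bar> \<ge> e\<close> infinitely often, take the limit
  \<open>L\<close> along an ultrafilter on these indices. \<open>L\<close> is a bounded functional
  that vanishes on \<open>A\<close>, hence also at \<open>x0\<close>, a contradiction.\<close>

lemma tendsto_zero_on_closure:
  fixes g :: "nat \<Rightarrow> 'f \<Rightarrow>\<^sub>L real"
  assumes bd: "\<And>m. norm (g m) \<le> 1"
    and ev: "\<And>x. x \<in> A \<Longrightarrow> eventually (\<lambda>m. g m x = 0) sequentially"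
    and x0: "x0 \<in> \<T> closure_of A"
  shows "(\<lambda>m. g m x0) \<longlonglongrightarrow> 0"
proof (rule tendstoI, rule ccontr)
  fix e :: real assume e: "0 < e"
  assume no: "\<not> eventually (\<lambda>m. dist (g m x0) 0 < e) sequentially"
  define F0 where "F0 = inf sequentially (principal {m. e \<le> \<bar>g m x0\<bar>})"
  have "F0 \<noteq> bot"
    using no by (simp add: F0_def trivial_limit_def eventually_inf_principal not_le)
  then obtain F where F: "ultrafilter F" "F \<le> F0" by (rule ultrafilter_exists)
  have F_seq: "eventually P F" if "eventually P sequentially" for P
    using that F(2) by (auto simp: F0_def intro: filter_leD)
  have F_e: "eventually (\<lambda>m. e \<le> \<bar>g m x0\<bar>) F"
    using F(2) by (simp add: F0_def le_principal)
  have "\<bar>g m v\<bar> \<le> norm v" for m v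
    using norm_blinfun[of "g m" v] mult_left_le_one_le[OF norm_ge_zero[of v] norm_ge_zero bd[of m]] by simp
  then obtain L where L: "linear L" "\<And>v. ((\<lambda>m. g m v) \<longlongrightarrow> L v) F" "\<And>v. \<bar>L v\<bar> \<le> norm v"
    using ultralimit_linear[OF F(1), of "\<lambda>m v. g m v" norm] by (auto simp: linear_blinfun_apply)
  have bl: "bounded_linear L" using bounded_linear_of_bound[of L 1] L by simp
  have "Blinfun L x = 0" if "x \<in> A" for x
  proof -
    have "((\<lambda>m. g m x) \<longlongrightarrow> 0) F"
      using F_seq[OF ev[OF that]] by (rule tendsto_eventually)
    then show ?thesis
      using tendsto_unique[OF ultrafilter_not_bot[OF F(1)] L(2)] by (simp add: bounded_linear_Blinfun_apply[OF bl])
  qed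
  then have "L x0 = 0"
    using functional_eq_closure[OF x0, of "Blinfun L"] by (simp add: bounded_linear_Blinfun_apply[OF bl])
  moreover have "e \<le> \<bar>L x0\<bar>"
    by (rule tendsto_lowerbound[OF tendsto_rabs[OF L(2)] F_e ultrafilter_not_bot[OF F(1)]])
  ultimately show False using e by simp
qed

text \<open>The conclusion bounds the distance in the bidual from \<open>z\<close> to the canonical
  image of the space by \<open>d\<close>, for one fixed \<open>d\<close>; completeness later handles
  \<open>d\<close> tending to 0.\<close>

lemma near_point:
  assumes K: "compactin \<T> (\<T> closure_of S)"
    and B: "\<And>x. x \<in> S \<Longrightarrow> norm x \<le> B"
    and z: "linear z"
    and approx: "\<And>P \<epsilon>. finite P \<Longrightarrow> 0 < \<epsilon> \<Longrightarrow>
          \<exists>y\<in>convex hull S. \<forall>f\<in>P. \<bar>blinfun_apply f y - z f\<bar> < (\<epsilon> :: real)"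
    and d: "0 < d"
  shows "\<exists>x. \<forall>f. \<bar>z f - blinfun_apply f x\<bar> \<le> d * norm f"
proof (rule ccontr)
  assume "\<not> ?thesis"
  then have far: "\<And>x. \<exists>f. d * norm f < \<bar>z f - blinfun_apply f x\<bar>" by (meson not_le)
  \<comment> \<open>A state holds the functionals \<open>P\<close> chosen so far and the points
    \<open>G\<close> at which the next functional must vanish.\<close>
  define Inv where "Inv = (\<lambda>(P, G). finite P \<and> finite G \<and> G \<subseteq> S \<and> (\<forall>f\<in>P. d < z f))"
  define step where "step = (\<lambda>(P, G) (P', G') (f :: 'f \<Rightarrow>\<^sub>L real) y. norm f = 1 \<and> (\<forall>x\<in>G. blinfun_apply f x = 0) \<and>
      P' = insert f P \<and> G \<subseteq> G' \<and> y \<in> convex hull G' \<and> (\<forall>f\<in>P'. d / 2 < blinfun_apply f y))"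
  have "\<exists>st. \<forall>n::nat. Inv (st n) \<and> (\<exists>f y. step (st n) (st (Suc n)) f y)"
  proof (rule dependent_nat_choice)
    show "\<exists>st. Inv st" by (intro exI[of _ "({}, {})"]) (simp add: Inv_def)
  next
    fix st and n :: nat assume inv: "Inv st"
    obtain P G where st: "st = (P, G)" by (cases st)
    have PG: "finite P" "finite G" "G \<subseteq> S" "\<forall>f\<in>P. d < z f" using inv by (auto simp: Inv_def st)
    obtain f where f: "norm f = 1" "\<And>x. x \<in> G \<Longrightarrow> blinfun_apply f x = 0" "d < z f"
      by (rule Helly_annihilator[OF z d PG(2) far]) blast
    obtain y where y: "y \<in> convex hull S" "\<forall>f\<in>insert f P. \<bar>blinfun_apply f y - z f\<bar> < d / 2"
      using approx[of "insert f P" "d / 2"] PG(1) d by auto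
    obtain G1 where G1: "finite G1" "G1 \<subseteq> S" "y \<in> convex hull G1"
      by (rule convex_hull_finite_subset[OF y(1)])
    have "y \<in> convex hull (G \<union> G1)" using G1(3) hull_mono[of G1 "G \<union> G1" convex] by auto
    moreover have "d / 2 < blinfun_apply h y" if "h \<in> insert f P" for h
    proof -
      have "d < z h" "\<bar>blinfun_apply h y - z h\<bar> < d / 2" using that y(2) f(3) PG(4) by auto
      then show ?thesis by linarith
    qed
    ultimately have "step st (insert f P, G \<union> G1) f y" using f by (simp add: step_def st)
    moreover have "Inv (insert f P, G \<union> G1)" using PG G1 f(3) by (simp add: Inv_def)
    ultimately show "\<exists>st'. Inv st' \<and> (\<exists>f y. step st st' f y)" by blast
  qed
  then obtain st where st: "\<And>n::nat. Inv (st n)" "\<forall>n. \<exists>f y. step (st n) (st (Suc n)) f y" by blast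
  then obtain f y where fy: "\<And>n. step (st n) (st (Suc n)) (f n) (y n)" by metis
  define G where "G n = snd (st n)" for n
  have f1: "norm (f n) = 1" and fG: "x \<in> G n \<Longrightarrow> blinfun_apply (f n) x = 0"
    and G_Suc: "G n \<subseteq> G (Suc n)" and y_hull: "y n \<in> convex hull G (Suc n)" for n x
    using fy[of n] by (auto simp: step_def G_def case_prod_unfold)
  have fP: "f n \<in> fst (st (Suc n))" and P_Suc: "fst (st n) \<subseteq> fst (st (Suc n))"
    and P_y: "h \<in> fst (st (Suc n)) \<Longrightarrow> d / 2 < blinfun_apply h (y n)" for n h
    using fy[of n] by (auto simp: step_def case_prod_unfold)
  have GS: "G n \<subseteq> S" for n using st(1)[of n] by (simp add: Inv_def G_def case_prod_unfold)
  have G_mono: "G m \<subseteq> G n" if "m \<le> n" for m n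
    using that by (rule lift_Suc_mono_le[of G, OF G_Suc])
  have P_mono: "fst (st m) \<subseteq> fst (st n)" if "m \<le> n" for m n
    using that by (rule lift_Suc_mono_le[of "\<lambda>n. fst (st n)", OF P_Suc])
  \<comment> \<open>Functionals are large at all points chosen at the same stage or later, since old
    functionals stay in the first component of the state.\<close>
  have fy_gt: "d / 2 < blinfun_apply (f m) (y n)" if "m \<le> n" for m n
    using P_y[of "f m" n] fP[of m] P_mono[of "Suc m" "Suc n"] that by auto

  define K0 where "K0 = (\<Union>n. G n)"
  define K1 where "K1 = \<T> closure_of K0"
  have K0S: "K0 \<subseteq> S" using GS by (auto simp: K0_def)
  have K01: "K0 \<subseteq> K1" unfolding K1_def by (rule closure_of_subset) simp
  have K1: "compactin \<T> K1"
    unfolding K1_def by (rule closed_compactin[OF K closure_of_mono[OF K0S]]) simp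
  have "G 1 \<noteq> {}" using y_hull[of 0] by auto
  then have K1_ne: "K1 \<noteq> {}" using K01 by (auto simp: K0_def)
  have yK: "y n \<in> convex hull K0" for n
    using y_hull[of n] hull_mono[of "G (Suc n)" K0 convex] by (auto simp: K0_def)
  have y_norm: "norm (y n) \<le> B" for n
  proof (rule norm_le_hull_closure[of _ S])
    have "convex hull K0 \<subseteq> \<T> closure_of (convex hull S)"
      using hull_mono[OF K0S, of convex] closure_of_subset[of "convex hull S" \<T>] by auto
    then show "y n \<in> \<T> closure_of (convex hull S)" using yK by blast
  qed (rule B)

  \<comment> \<open>The sublinear functional for Simons' inequality. Compactness of
    \<open>K1\<close> makes the supremum attained, so evaluation at a maximiser supports
    \<open>Sup1\<close> at any given \<open>g\<close>.\<close>
  define Sup1 where "Sup1 g = (SUP x\<in>K1. blinfun_apply g x)" for g :: "'f \<Rightarrow>\<^sub>L real"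
  have attain: "\<exists>x\<in>K1. \<forall>y\<in>K1. blinfun_apply g y \<le> blinfun_apply g x" for g :: "'f \<Rightarrow>\<^sub>L real"
  proof -
    have "compact (blinfun_apply g ` K1)" using image_compactin[OF K1 continuous_blinfun] by simp
    then show ?thesis using compact_attains_sup[of "blinfun_apply g ` K1"] K1_ne by auto
  qed
  have Sup1_ge: "blinfun_apply g x \<le> Sup1 g" if "x \<in> K1" for g x
    unfolding Sup1_def
  proof (rule cSUP_upper[OF that])
    show "bdd_above (blinfun_apply g ` K1)" using attain[of g] by (auto simp: bdd_above_def)
  qed
  have Sup1_le: "Sup1 g \<le> c" if "\<And>x. x \<in> K1 \<Longrightarrow> blinfun_apply g x \<le> c" for g c
    unfolding Sup1_def using K1_ne that by (rule cSUP_least)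
  have Sup1: "sublinear Sup1"
  proof (rule sublinearI)
    show "Sup1 (g + h) \<le> Sup1 g + Sup1 h" for g h
      by (rule Sup1_le) (simp add: blinfun.add_left add_mono Sup1_ge)
    show "Sup1 (r *\<^sub>R g) \<le> r * Sup1 g" if "0 < r" for r g
      by (rule Sup1_le) (use that in \<open>simp add: blinfun.scaleR_left mult_left_mono Sup1_ge\<close>)
  qed

  txt \<open>The sets \<open>A n\<close> replace the closed convex hulls of the \<open>f m\<close> with \<open>m \<ge> n\<close>.\<close>
  define A where "A n = {g :: 'f \<Rightarrow>\<^sub>L real. norm g \<le> 1 \<and> (\<forall>x\<in>G n. blinfun_apply g x = 0) \<and>
      (\<forall>e>0. eventually (\<lambda>m. d / 2 - e \<le> blinfun_apply g (y m)) sequentially)}" for n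
  have A_convex: "convex (A n)" for n
  proof (rule convexI)
    fix g h and u v :: real assume gh: "g \<in> A n" "h \<in> A n" and uv: "0 \<le> u" "0 \<le> v" "u + v = 1"
    have "norm (u *\<^sub>R g + v *\<^sub>R h) \<le> u * 1 + v * 1"
      using gh uv by (intro norm_triangle_le add_mono) (auto simp: A_def mult_left_le)
    moreover have "eventually (\<lambda>m. d / 2 - e \<le> (u *\<^sub>R g + v *\<^sub>R h) (y m)) sequentially" if "0 < e" for e
    proof -
      have "eventually (\<lambda>m. d / 2 - e \<le> g (y m)) sequentially" "eventually (\<lambda>m. d / 2 - e \<le> h (y m)) sequentially"
        using gh that by (auto simp: A_def)
      then show ?thesis
      proof eventually_elim
        case (elim m)
        have "u * (d / 2 - e) + v * (d / 2 - e) \<le> u * g (y m) + v * h (y m)"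
          using elim uv by (intro add_mono mult_left_mono) auto
        then show ?case using uv by (simp add: blinfun.add_left blinfun.scaleR_left flip: distrib_right)
      qed
    qed
    ultimately show "u *\<^sub>R g + v *\<^sub>R h \<in> A n"
      using gh uv by (auto simp: A_def blinfun.add_left blinfun.scaleR_left)
  qed
  have A_closed: "closed (A n)" for n
  proof (subst closed_sequential_limits, intro allI impI, elim conjE)
    fix a l assume a: "\<forall>k. a k \<in> A n" and lim: "a \<longlonglongrightarrow> l"
    have "norm l \<le> 1"
      by (rule tendsto_upperbound[OF tendsto_norm[OF lim]]) (use a in \<open>auto simp: A_def\<close>)
    moreover have "l x = 0" if "x \<in> G n" for x
    proof (rule LIMSEQ_unique)
      show "(\<lambda>k. a k x) \<longlonglongrightarrow> l x" by (intro tendsto_intros lim)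
      show "(\<lambda>k. a k x) \<longlonglongrightarrow> 0" using a that by (simp add: A_def)
    qed
    moreover have "eventually (\<lambda>m. d / 2 - e \<le> l (y m)) sequentially" if e: "0 < e" for e
    proof -
      \<comment> \<open>All \<open>y m\<close> have norm at most \<open>B\<close>, so an
        approximation within this radius changes every value at \<open>y m\<close> by at most
        \<open>e / 2\<close>. The summand 1 keeps the denominator positive.\<close>
      have "0 < e / (2 * (\<bar>B\<bar> + 1))" using e by (simp add: add_nonneg_pos)
      then obtain k where k: "norm (a k - l) < e / (2 * (\<bar>B\<bar> + 1))"
        using LIMSEQ_D[OF lim] by blast
      have close: "\<bar>a k (y m) - l (y m)\<bar> \<le> e / 2" for m
      proof -
        have "\<bar>a k (y m) - l (y m)\<bar> \<le> norm (a k - l) * norm (y m)"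
          using norm_blinfun[of "a k - l" "y m"] by (simp add: blinfun.diff_left)
        also have "\<dots> \<le> e / (2 * (\<bar>B\<bar> + 1)) * (\<bar>B\<bar> + 1)"
          using k y_norm[of m] e by (intro mult_mono) auto
        also have "\<dots> = e / 2" by (simp add: field_simps)
        finally show ?thesis .
      qed
      have "eventually (\<lambda>m. d / 2 - e / 2 \<le> a k (y m)) sequentially"
        using a e by (auto simp: A_def)
      then show ?thesis
      proof eventually_elim
        case (elim m)
        then show ?case using close[of m] by linarith
      qed
    qed
    ultimately show "l \<in> A n" by (simp add: A_def)
  qed
  have A_dec: "A n \<subseteq> A m" if "m \<le> n" for m n using G_mono[OF that] by (auto simp: A_def)
  have fA: "f n \<in> A n" for n
  proof -
    have "eventually (\<lambda>m. d / 2 - e \<le> f n (y m)) sequentially" if "0 < e" for e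
      using eventually_ge_at_top[of n]
    proof eventually_elim
      case (elim m)
      then show ?case using fy_gt[OF elim] that by linarith
    qed
    then show ?thesis using f1 fG by (simp add: A_def)
  qed
  \<comment> \<open>Some \<open>y m\<close> nearly witnesses the value \<open>d / 2\<close>, and as
    a convex combination of points of \<open>K0\<close> it cannot exceed the supremum over
    \<open>K1\<close>.\<close>
  have A_Sup1: "d / 2 \<le> Sup1 g" if "g \<in> A 0" for g
  proof (rule field_le_epsilon)
    fix e :: real assume "0 < e"
    then have "eventually (\<lambda>m. d / 2 - e \<le> g (y m)) sequentially"
      using that by (simp add: A_def)
    then obtain m where m: "d / 2 - e \<le> g (y m)"
      by (auto simp: eventually_sequentially)
    have "g (y m) \<le> Sup1 g"
      by (rule functional_le_hull[OF yK]) (use K01 in \<open>auto intro: Sup1_ge\<close>)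
    with m show "d / 2 \<le> Sup1 g + e" by linarith
  qed
  have A_nonempty: "A n \<noteq> {}" for n using fA by blast
  have A_decseq: "decseq A" using A_dec by (simp add: decseq_def)
  have A_norm: "norm g \<le> 1" if "g \<in> A 0" for g using that by (simp add: A_def)
  have "\<exists>g. (\<forall>n. g n \<in> A n) \<and> (\<forall>b n. bounded_linear b \<longrightarrow> (\<forall>h. b h \<le> Sup1 h) \<longrightarrow>
      b (\<Sum>m. (1/2) ^ Suc m *\<^sub>R g m) = Sup1 (\<Sum>m. (1/2) ^ Suc m *\<^sub>R g m) \<longrightarrow>
      d / 2 / 2 \<le> (\<Sum>m. (1/2) ^ Suc m * b (g (m + n))))"
    by (rule Simons_inequality[OF Sup1 A_convex A_closed A_nonempty A_decseq A_norm half_gt_zero[OF d] A_Sup1])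
  then obtain g where g: "(\<forall>n. g n \<in> A n) \<and> (\<forall>b n. bounded_linear b \<longrightarrow> (\<forall>h. b h \<le> Sup1 h) \<longrightarrow>
      b (\<Sum>m. (1/2) ^ Suc m *\<^sub>R g m) = Sup1 (\<Sum>m. (1/2) ^ Suc m *\<^sub>R g m) \<longrightarrow>
      d / 2 / 2 \<le> (\<Sum>m. (1/2) ^ Suc m * b (g (m + n))))" ..
  note gA = spec[OF conjunct1[OF g]] and tails = conjunct2[OF g]
  define H where "H = (\<Sum>m. (1/2) ^ Suc m *\<^sub>R g m)"
  obtain x0 where x0: "x0 \<in> K1" "\<And>x. x \<in> K1 \<Longrightarrow> blinfun_apply H x \<le> blinfun_apply H x0"
    using attain[of H] by blast
  \<comment> \<open>Evaluation at the maximiser \<open>x0\<close> is the functional \<open>b\<close>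
    to which the inequality applies; it gives the same lower bound for all tails.\<close>
  have "blinfun_apply H x0 = Sup1 H" using Sup1_le[OF x0(2)] Sup1_ge[OF x0(1)] by (intro antisym)
  then have tails0: "d / 4 \<le> (\<Sum>m. (1/2) ^ Suc m * blinfun_apply (g (m + n)) x0)" for n
    using tails[rule_format, of "\<lambda>h. blinfun_apply h x0" n] Sup1_ge[OF x0(1)] blinfun.bounded_linear_left
    by (simp add: H_def)
  \<comment> \<open>Each point of \<open>K0\<close> lies in some \<open>G n\<close>, where all
    \<open>g m\<close> with \<open>m \<ge> n\<close> vanish. The values therefore tend to 0 at
    \<open>x0\<close> too, and late tails fall below \<open>d / 4\<close>.\<close>
  have "(\<lambda>m. g m x0) \<longlonglongrightarrow> 0"
  proof (rule tendsto_zero_on_closure[of g K0])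
    show "norm (g m) \<le> 1" for m using gA[of m] by (simp add: A_def)
    show "eventually (\<lambda>m. g m x = 0) sequentially" if x: "x \<in> K0" for x
    proof -
      obtain n where n: "x \<in> G n" using x by (auto simp: K0_def)
      show ?thesis using eventually_ge_at_top[of n]
      proof eventually_elim
        case (elim m)
        then show ?case using gA[of m] G_mono[of n m] n by (auto simp: A_def)
      qed
    qed
  qed (use x0(1) in \<open>simp add: K1_def\<close>)
  then have "eventually (\<lambda>m. dist (g m x0) 0 < d / 8) sequentially" using d by (intro tendstoD) auto
  then obtain n where n: "\<And>m. n \<le> m \<Longrightarrow> \<bar>g m x0\<bar> < d / 8" by (auto simp: eventually_sequentially)
  have half: "(\<lambda>m. (1/2) ^ Suc m * (d / 8)) sums (1 * (d / 8))"
    by (rule sums_mult2[OF power_half_series])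
  have "summable (\<lambda>m. (1/2) ^ Suc m * g (m + n) x0)"
  proof (rule summable_comparison_test[OF _ sums_summable[OF half]], intro exI allI impI)
    show "norm ((1/2) ^ Suc m * g (m + n) x0) \<le> (1/2) ^ Suc m * (d / 8)" for m
      using n[of "m + n"] by (simp add: abs_mult)
  qed
  then have "(\<Sum>m. (1/2) ^ Suc m * g (m + n) x0) \<le> (\<Sum>m. (1/2) ^ Suc m * (d / 8))"
  proof (rule suminf_le[rotated])
    show "(1/2) ^ Suc m * g (m + n) x0 \<le> (1/2) ^ Suc m * (d / 8)" for m
      using n[of "m + n"] by (intro mult_left_mono) auto
  qed (rule sums_summable[OF half])
  also have "\<dots> = d / 8" using sums_unique[OF half] by simp
  finally show False using tails0[of n] d by simp
qed

text \<open>The limit \<open>z\<close> in the bidual is approximated by points \<open>x n\<close> of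
  the space within \<open>1 / (n + 1)\<close>. They form a Cauchy sequence whose limit represents
  \<open>z\<close>.\<close>

lemma ultrafilter_weak_limit:
  assumes K: "compactin \<T> (\<T> closure_of S)"
    and B: "\<And>x. x \<in> S \<Longrightarrow> norm x \<le> B"
    and F: "ultrafilter F" "eventually (\<lambda>y. y \<in> \<T> closure_of (convex hull S)) F"
  obtains x where "\<And>f :: 'f \<Rightarrow>\<^sub>L real. ((\<lambda>y. f y) \<longlongrightarrow> f x) F"
proof -
  have bd: "eventually (\<lambda>y. \<bar>blinfun_apply f y\<bar> \<le> norm f * B) F" for f :: "'f \<Rightarrow>\<^sub>L real"
    using F(2)
  proof eventually_elim
    case (elim y)
    have "\<bar>f y\<bar> \<le> norm f * norm y" using norm_blinfun[of f y] by simp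
    also have "\<dots> \<le> norm f * B" by (intro mult_left_mono norm_le_hull_closure[OF elim] B) auto
    finally show ?case .
  qed
  have lin: "linear (\<lambda>f :: 'f \<Rightarrow>\<^sub>L real. blinfun_apply f y)" for y
    by (simp add: linear_iff blinfun.add_left blinfun.scaleR_left)
  obtain z where z: "linear z" "\<And>f :: 'f \<Rightarrow>\<^sub>L real. ((\<lambda>y. blinfun_apply f y) \<longlongrightarrow> z f) F"
    using ultralimit_linear[OF F(1) lin bd] by blast
  have approx: "\<exists>y\<in>convex hull S. \<forall>f\<in>P. \<bar>blinfun_apply f y - z f\<bar> < \<epsilon>"
    if P: "finite P" and \<epsilon>: "0 < \<epsilon>" for P and \<epsilon> :: real
  proof -
    have "eventually (\<lambda>y. \<forall>f\<in>P. \<bar>blinfun_apply f y - z f\<bar> < \<epsilon>) F"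
      using tendstoD[OF z(2) \<epsilon>] P by (auto simp: dist_real_def eventually_ball_finite_distrib)
    with F(2) have "eventually (\<lambda>y. y \<in> \<T> closure_of (convex hull S) \<and> (\<forall>f\<in>P. \<bar>blinfun_apply f y - z f\<bar> < \<epsilon>)) F"
      by eventually_elim simp
    then obtain y where y: "y \<in> \<T> closure_of (convex hull S)" "\<forall>f\<in>P. \<bar>blinfun_apply f y - z f\<bar> < \<epsilon>"
      using eventually_happens'[OF ultrafilter_not_bot[OF F(1)]] by blast
    \<comment> \<open>A weak neighbourhood of \<open>y\<close> given by the finitely many
      functionals in \<open>P\<close>; it moves the approximating point from the closure into the
      convex hull itself.\<close>
    define U where "U = (\<Inter>f\<in>P. {x \<in> topspace \<T>. blinfun_apply f x \<in> ball (z f) \<epsilon>}) \<inter> topspace \<T>"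
    have U: "openin \<T> U" unfolding U_def
      by (rule openin_INT[OF P]) (rule openin_continuous_map_preimage[OF continuous_blinfun], simp)
    have "y \<in> U" using y(2) by (auto simp: U_def dist_real_def abs_minus_commute)
    from closure_of_meets[OF y(1) U this] show ?thesis
      by (auto simp: U_def dist_real_def abs_minus_commute)
  qed
  have "\<exists>x. \<forall>n. \<forall>f. \<bar>z f - blinfun_apply f (x n)\<bar> \<le> inverse (real (Suc n)) * norm f"
    by (rule choice) (intro allI near_point[OF K B z(1) approx], auto)
  then obtain x where x: "\<And>n f. \<bar>z f - blinfun_apply f (x n)\<bar> \<le> inverse (real (Suc n)) * norm f" by blast
  \<comment> \<open>A norming functional for \<open>x m - x n\<close> compares both points with
    \<open>z\<close>.\<close>
  have dist_x: "dist (x m) (x n) \<le> inverse (real (Suc m)) + inverse (real (Suc n))" for m n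
  proof -
    obtain f :: "'f \<Rightarrow>\<^sub>L real" where f: "norm f \<le> 1" "f (x m - x n) = norm (x m - x n)"
      by (rule norming_functional)
    have *: "\<bar>z f - f (x k)\<bar> \<le> inverse (real (Suc k))" for k
      by (rule order_trans[OF x mult_left_le[OF f(1)]]) simp
    show ?thesis
      using *[of m] *[of n] f(2) unfolding blinfun.diff_right dist_norm by linarith
  qed
  have "Cauchy x"
  proof (rule metric_CauchyI)
    fix e :: real assume "0 < e"
    then obtain N where N: "inverse (real (Suc N)) < e / 2" using reals_Archimedean[of "e / 2"] by auto
    show "\<exists>M. \<forall>m\<ge>M. \<forall>n\<ge>M. dist (x m) (x n) < e"
    proof (intro exI allI impI)
      fix m n assume "N \<le> m" "N \<le> n"
      then have "inverse (real (Suc m)) \<le> inverse (real (Suc N))" "inverse (real (Suc n)) \<le> inverse (real (Suc N))"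
        by (auto intro!: le_imp_inverse_le)
      then show "dist (x m) (x n) < e" using dist_x[of m n] N by linarith
    qed
  qed
  then obtain l where l: "x \<longlonglongrightarrow> l" by (auto simp: Cauchy_convergent_iff convergent_def)
  have "z f = f l" for f :: "'f \<Rightarrow>\<^sub>L real"
  proof -
    have "(\<lambda>n. inverse (real (Suc n)) * norm f) \<longlonglongrightarrow> 0 * norm f"
      by (intro tendsto_mult LIMSEQ_inverse_real_of_nat tendsto_const)
    moreover have "(\<lambda>n. \<bar>z f - f (x n)\<bar>) \<longlonglongrightarrow> \<bar>z f - f l\<bar>" by (intro tendsto_intros l)
    ultimately have "\<bar>z f - f l\<bar> \<le> 0 * norm f"
      using x[of f] by (intro LIMSEQ_le[of "\<lambda>n. \<bar>z f - f (x n)\<bar>"]) blast+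
    then show ?thesis by simp
  qed
  then show ?thesis using that z(2) by metis
qed

text \<open>Total boundedness upgrades the weak limit to a \<open>\<T>\<close>-limit: the
  ultrafilter settles in one translate \<open>k + 3 V\<close>, and separation keeps the weak limit
  in \<open>k + 4 V\<close>.\<close>

theorem Krein:
  assumes K: "compactin \<T> (\<T> closure_of S)"
    and B: "\<And>x. x \<in> S \<Longrightarrow> norm x \<le> B"
  shows "compactin \<T> (\<T> closure_of (convex hull S))"
proof (rule compactin_ultrafilterI)
  fix F assume F: "ultrafilter F" "eventually (\<lambda>y. y \<in> \<T> closure_of (convex hull S)) F"
  obtain x where x: "\<And>f :: 'f \<Rightarrow>\<^sub>L real. ((\<lambda>y. f y) \<longlongrightarrow> f x) F"
    using ultrafilter_weak_limit[OF K B F] by blast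
  have lim: "eventually (\<lambda>y. y \<in> U) F" if U: "openin \<T> U" "x \<in> U" for U
  proof -
    \<comment> \<open>The factor 7 is 3 + 4, since
      \<open>y - x = 3 *\<^sub>R v - 4 *\<^sub>R w\<close> below.\<close>
    obtain V where V: "openin \<T> V" "convex V" "0 \<in> V" "\<And>v. v \<in> V \<Longrightarrow> - v \<in> V"
      and VU: "\<And>v. v \<in> V \<Longrightarrow> x + 7 *\<^sub>R v \<in> U"
      by (rule symmetric_convex_neighbourhood[OF U, of 7]) blast
    obtain G where G: "finite G"
      "\<And>y. y \<in> \<T> closure_of (convex hull S) \<Longrightarrow> \<exists>k\<in>G. \<exists>v\<in>V. y = k + 3 *\<^sub>R v"
      using closure_convex_hull_totally_bounded[OF K V(1,3,2,4)] by blast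
    have "eventually (\<lambda>y. \<exists>k\<in>G. \<exists>v\<in>V. y = k + 3 *\<^sub>R v) F"
      using F(2) by eventually_elim (rule G(2))
    then obtain k where k: "eventually (\<lambda>y. \<exists>v\<in>V. y = k + 3 *\<^sub>R v) F"
      using ultrafilter_finite_union[OF F(1) G(1), of "\<lambda>k y. \<exists>v\<in>V. y = k + 3 *\<^sub>R v"] by blast
    define w where "w = (1/4) *\<^sub>R (x - k)"
    \<comment> \<open>A functional \<open>g\<close> with \<open>g \<le> 1\<close> on
      \<open>V\<close> satisfies \<open>g y \<le> g k + 3\<close> along \<open>F\<close>, hence
      \<open>g x \<le> g k + 3\<close>; but \<open>1 \<le> g w\<close> means
      \<open>g x \<ge> g k + 4\<close>.\<close>
    have "w \<in> V"
    proof (rule ccontr)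
      assume "w \<notin> V"
      then obtain g where g: "linear g" "continuous_map \<T> euclideanreal g" "\<And>v. v \<in> V \<Longrightarrow> g v \<le> (1::real)" "1 \<le> g w"
        using separation[OF V(1,2,3)] by blast
      have bl: "bounded_linear g" using continuous_iff_bounded[OF g(1)] g(2) by simp
      have "eventually (\<lambda>y. g y \<le> g k + 3) F"
        using k
      proof eventually_elim
        case (elim y)
        then show ?case using g(3) by (auto simp: linear_add[OF g(1)] linear_scale[OF g(1)])
      qed
      then have "g x \<le> g k + 3"
        using tendsto_upperbound[OF _ _ ultrafilter_not_bot[OF F(1)]] x[of "Blinfun g"]
        by (simp add: bounded_linear_Blinfun_apply[OF bl])
      then show False using g(4) by (simp add: w_def linear_diff[OF g(1)] linear_scale[OF g(1)])
    qed
    show ?thesis using k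
    proof eventually_elim
      case (elim y)
      then obtain v where v: "v \<in> V" "y = k + 3 *\<^sub>R v" by blast
      have "(4/7) *\<^sub>R (- w) + (3/7) *\<^sub>R v \<in> V"
        by (rule convexD[OF V(2) V(4)[OF \<open>w \<in> V\<close>] v(1)]) auto
      from VU[OF this] show ?case by (simp add: v(2) w_def algebra_simps)
    qed
  qed
  have "x \<in> \<T> closure_of (convex hull S)"
  proof (rule ccontr)
    assume "x \<notin> \<T> closure_of (convex hull S)"
    then have "eventually (\<lambda>y. y \<in> topspace \<T> - \<T> closure_of (convex hull S)) F"
      by (intro lim openin_diff openin_topspace closedin_closure_of) simp
    with F(2) have "eventually (\<lambda>y. False) F" by eventually_elim auto
    then show False using ultrafilter_not_bot[OF F(1)] by (simp add: trivial_limit_def)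
  qed
  then show "\<exists>x\<in>\<T> closure_of (convex hull S). \<forall>U. openin \<T> U \<longrightarrow> x \<in> U \<longrightarrow> eventually (\<lambda>y. y \<in> U) F"
    using lim by blast
qed simp

text \<open>A Mazur argument: comparison of the two topologies is available only through
  functionals, so a point outside the \<open>\<T>\<close>-closure is separated by a functional that
  is also norm continuous.\<close>

lemma closure_convex_subset:
  assumes C: "convex C"
  shows "closure C \<subseteq> \<T> closure_of C"
proof
  fix x assume x: "x \<in> closure C"
  show "x \<in> \<T> closure_of C"
  proof (rule ccontr)
    assume "x \<notin> \<T> closure_of C"
    then obtain U where U: "openin \<T> U" "x \<in> U" "\<And>c. c \<in> C \<Longrightarrow> c \<notin> U" by (auto simp: in_closure_of)
    obtain V where V: "openin \<T> V" "convex V" "0 \<in> V" "\<And>v. v \<in> V \<Longrightarrow> - v \<in> V"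
      and VU: "\<And>v. v \<in> V \<Longrightarrow> x + 1 *\<^sub>R v \<in> U"
      by (rule symmetric_convex_neighbourhood[OF U(1,2), of 1]) blast
    obtain c0 where c0: "c0 \<in> C" using x by fastforce
    \<comment> \<open>This is \<open>C - c0 + V\<close>, a convex open neighbourhood of 0. It misses
      \<open>x - c0\<close> because \<open>V\<close> is symmetric and \<open>x + V\<close> misses
      \<open>C\<close>.\<close>
    define W where "W = (\<Union>c\<in>C. {w. (c0 - c) + 1 *\<^sub>R w \<in> V})"
    have W_open: "openin \<T> W" unfolding W_def
      by (rule openin_Union) (use openin_affine[OF V(1)] in blast)
    have W_convex: "convex W"
    proof (rule convexI)
      fix w1 w2 and u v :: real assume w: "w1 \<in> W" "w2 \<in> W" and uv: "0 \<le> u" "0 \<le> v" "u + v = 1"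
      obtain c1 c2 where c: "c1 \<in> C" "c2 \<in> C" "(c0 - c1) + w1 \<in> V" "(c0 - c2) + w2 \<in> V"
        using w by (auto simp: W_def)
      have "u *\<^sub>R ((c0 - c1) + w1) + v *\<^sub>R ((c0 - c2) + w2) \<in> V" using c uv V(2) by (intro convexD)
      also have "u *\<^sub>R ((c0 - c1) + w1) + v *\<^sub>R ((c0 - c2) + w2)
          = (u + v) *\<^sub>R c0 - (u *\<^sub>R c1 + v *\<^sub>R c2) + 1 *\<^sub>R (u *\<^sub>R w1 + v *\<^sub>R w2)"
        by (simp add: algebra_simps)
      finally show "u *\<^sub>R w1 + v *\<^sub>R w2 \<in> W"
        unfolding W_def using convexD[OF C c(1,2) uv] uv(3) by auto
    qed
    have W0: "0 \<in> W" using c0 V(3) by (auto simp: W_def intro!: bexI[of _ c0])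
    have "x - c0 \<notin> W"
    proof
      assume "x - c0 \<in> W"
      then obtain c where c: "c \<in> C" "x - c \<in> V" by (auto simp: W_def)
      show False using VU[OF V(4)[OF c(2)]] U(3)[OF c(1)] by simp
    qed
    then obtain g where g: "linear g" "continuous_map \<T> euclideanreal g" "\<And>w. w \<in> W \<Longrightarrow> g w \<le> (1::real)" "1 \<le> g (x - c0)"
      using separation[OF W_open W_convex W0] by blast
    have bl: "bounded_linear g" using continuous_iff_bounded[OF g(1)] g(2) by simp
    \<comment> \<open>The inequality \<open>g c \<le> g x - g v\<close> on \<open>C\<close> extends
      to the norm closure; taking \<open>c = x\<close> leaves \<open>g v \<le> 0\<close>. This
      conflicts with \<open>1 \<le> g (x - c0)\<close>, as \<open>V\<close> is absorbing.\<close>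
    have nonpos: "g v \<le> 0" if v: "v \<in> V" for v
    proof -
      have "g c \<le> g x - g v" if c: "c \<in> C" for c
      proof -
        have "g (c - c0 + v) \<le> 1" using c v by (intro g(3)) (auto simp: W_def intro!: bexI[of _ c])
        then show ?thesis using g(4) by (simp add: linear_add[OF g(1)] linear_diff[OF g(1)])
      qed
      moreover have "closed {c. g c \<le> g x - g v}"
        by (intro closed_Collect_le linear_continuous_on[OF bl] continuous_on_const)
      ultimately have "closure C \<subseteq> {c. g c \<le> g x - g v}" by (intro closure_minimal) auto
      then show ?thesis using x by auto
    qed
    obtain r where r: "0 < r" "r *\<^sub>R (x - c0) \<in> V" by (rule absorbing[OF V(1,3)])
    have "r * g (x - c0) \<le> 0" using nonpos[OF r(2)] by (simp add: linear_scale[OF g(1)])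
    then show False using r(1) g(4) by (simp add: mult_le_0_iff)
  qed
qed

end

subsection \<open>Real and scalar functionals\<close>

lemma normed_scalingD:
  assumes "normed_scaling t"
  shows "vector_space t" "t (of_real r) x = r *\<^sub>R x" "norm (t c x) = norm c * norm x"
    "t c (x + y) = t c x + t c y" "t (c + d) x = t c x + t d x" "t c (t d x) = t (c * d) x"
    "t 1 x = x"
  using assms by (auto simp: normed_scaling_def vector_space_def)

lemma bounded_linear_scaling:
  assumes "normed_scaling t"
  shows "bounded_linear (t c)"
proof (rule bounded_linear_intro[of _ "norm c"])
  show "t c (r *\<^sub>R x) = r *\<^sub>R t c x" for r x
    by (simp add: normed_scalingD[OF assms] mult.commute flip: normed_scalingD(2)[OF assms])
qed (simp_all add: normed_scalingD[OF assms] mult.commute)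

text \<open>The form \<open>(c, d) \<mapsto> (c * d) \<bullet> 1\<close> on the scalar field is nondegenerate, so a real functional \<open>g\<close>
  determines a scalar functional \<open>f\<close> by \<open>(c * f x) \<bullet> 1 = g (t c x)\<close>; for complex scalars, \<open>g\<close> is
  the real part of \<open>f\<close>.\<close>

lemma scalar_functional_of_real:
  fixes t :: "'k::{real_normed_field, euclidean_space} \<Rightarrow> 'f::real_normed_vector \<Rightarrow> 'f"
    and g :: "'f \<Rightarrow> real"
  assumes t: "normed_scaling t" and g: "linear g"
  obtains L :: "'k \<Rightarrow> 'k" where "linear L"
    "Vector_Spaces.linear t (*) (\<lambda>x. L (\<Sum>b\<in>Basis. g (t b x) *\<^sub>R b))"
    "\<And>x. g x = L (\<Sum>b\<in>Basis. g (t b x) *\<^sub>R b) \<bullet> 1"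
proof -
  \<comment> \<open>\<open>A d\<close> represents the functional
    \<open>c \<mapsto> (c * d) \<bullet> 1\<close> in the inner product of
    \<open>'k\<close>.\<close>
  define A :: "'k \<Rightarrow> 'k" where "A d = (\<Sum>b\<in>Basis. ((b * d) \<bullet> 1) *\<^sub>R b)" for d
  have A: "linear A"
    by (rule linearI)
      (simp_all add: A_def algebra_simps inner_add_left sum.distrib scaleR_add_left scaleR_sum_right)
  have A_inner: "c \<bullet> A d = (c * d) \<bullet> 1" for c d
  proof -
    have "linear (\<lambda>c. c \<bullet> A d)" "linear (\<lambda>c. (c * d) \<bullet> 1)"
      by (auto intro!: linearI simp: inner_add_left distrib_right)
    moreover have "b \<bullet> A d = (b * d) \<bullet> 1" if "b \<in> Basis" for b
      using that by (simp add: A_def inner_sum_right inner_Basis if_distrib cong: if_cong)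
    ultimately show ?thesis by (metis (mono_tags, lifting) linear_eq_stdbasis)
  qed
  \<comment> \<open>Nondegeneracy: a nonzero \<open>d\<close> is detected by pairing with
    \<open>inverse d\<close>.\<close>
  have "inj A"
  proof (rule linear_injective_0[OF A, THEN iffD2], intro allI impI, rule ccontr)
    fix d assume d: "A d = 0" "d \<noteq> 0"
    have "(inverse d * d) \<bullet> 1 = 0" using A_inner[of "inverse d" d] d(1) by simp
    then show False using d(2) by simp
  qed
  then obtain L where L: "linear L" "\<And>d. L (A d) = d" "\<And>d. A (L d) = d"
    using linear_injective_isomorphism[OF A] by blast
  \<comment> \<open>\<open>h x\<close> represents \<open>c \<mapsto> g (t c x)\<close>, so
    \<open>L\<close>, the inverse of \<open>A\<close>, turns it into the required scalar.\<close>
  define h where "h x = (\<Sum>b\<in>Basis. g (t b x) *\<^sub>R b)" for x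
  have h_inner: "c \<bullet> h x = g (t c x)" for c x
  proof -
    have "linear (\<lambda>c. g (t c x))"
    proof (rule linearI)
      show "g (t (r *\<^sub>R c) x) = r *\<^sub>R g (t c x)" for r c
        using linear_scale[OF g, of r "t c x"] normed_scalingD(2,6)[OF t]
        by (metis scaleR_conv_of_real)
    qed (simp add: normed_scalingD(5)[OF t] linear_add[OF g])
    moreover have "linear (\<lambda>c. c \<bullet> h x)" by (auto intro!: linearI simp: inner_add_left)
    moreover have "b \<bullet> h x = g (t b x)" if "b \<in> Basis" for b
      using that by (simp add: h_def inner_sum_right inner_Basis if_distrib cong: if_cong)
    ultimately show ?thesis by (metis (mono_tags, lifting) linear_eq_stdbasis)
  qed
  have f: "(c * L (h x)) \<bullet> 1 = g (t c x)" for c x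
    using A_inner[of c "L (h x)"] L(3) h_inner by simp
  have eqI: "d = e" if "\<And>c. (c * d) \<bullet> 1 = (c * e) \<bullet> 1" for d e :: 'k
  proof -
    have "A d = A e" unfolding A_def using that by simp
    then show ?thesis by (metis L(2))
  qed
  have lin: "Vector_Spaces.linear t (*) (\<lambda>x. L (h x))"
    unfolding Vector_Spaces.linear_iff
  proof (intro conjI allI)
    show "vector_space t" by (rule normed_scalingD(1)[OF t])
    show "vector_space ((*) :: 'k \<Rightarrow> _)" by unfold_locales (simp_all add: algebra_simps)
    show "L (h (x + y)) = L (h x) + L (h y)" for x y
      by (rule eqI) (simp add: f distrib_left inner_add_left normed_scalingD(4)[OF t] linear_add[OF g])
    show "L (h (t c x)) = c * L (h x)" for c x
      by (rule eqI) (simp add: f normed_scalingD(6)[OF t] flip: mult.assoc)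
  qed
  have g_eq: "g x = L (h x) \<bullet> 1" for x using f[of 1 x] normed_scalingD(7)[OF t] by simp
  show ?thesis by (rule that[OF L(1) lin[unfolded h_def] g_eq[unfolded h_def]])
qed

lemma continuous_linear_imp_bounded:
  fixes g :: "'f::real_normed_vector \<Rightarrow> real"
  assumes g: "linear g" and "continuous_on UNIV g"
  shows "bounded_linear g"
proof -
  have "isCont g 0" using assms(2) by (simp add: continuous_on_eq_continuous_at)
  then obtain e where e: "0 < e" "\<And>x. dist x 0 < e \<Longrightarrow> dist (g x) (g 0) < 1"
    unfolding continuous_at_eps_delta by (metis zero_less_one)
  have bd: "\<bar>g x\<bar> \<le> (2 / e) * norm x" for x
  proof (cases "x = 0")
    case False
    define r where "r = e / (2 * norm x)"
    have r: "0 < r" using False e(1) by (simp add: r_def)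
    have "dist (r *\<^sub>R x) 0 < e" using False e(1) by (simp add: r_def)
    then have "\<bar>r * g x\<bar> < 1" using e(2)[of "r *\<^sub>R x"] linear_0[OF g] linear_scale[OF g] by simp
    then have "\<bar>g x\<bar> < 1 / r" using r by (simp add: abs_mult field_simps)
    also have "1 / r = (2 / e) * norm x" using False e(1) by (simp add: r_def)
    finally show ?thesis by simp
  qed (simp add: linear_0[OF g])
  show ?thesis by (rule bounded_linear_of_bound[OF g bd])
qed

text \<open>The scalar functional \<open>f\<close> is a finite sum of continuous expressions in
  \<open>g (t b x)\<close>, and \<open>g\<close> is \<open>f\<close> followed by an inner product.
  Hence \<open>f\<close> and \<open>g\<close> are continuous together, in \<open>\<T>\<close> and in
  the norm topology alike.\<close>

lemma compatible_topology_real: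
  fixes t :: "'k::{real_normed_field, euclidean_space} \<Rightarrow> 'f::banach \<Rightarrow> 'f"
  assumes t: "normed_scaling t" and \<T>: "compatible_topology t \<T>"
  shows "norm_compatible_topology \<T>"
proof -
  have lc: "locally_convex_topology t \<T>" using \<T> by (simp add: compatible_topology_def)
  have compat: "continuous_map \<T> euclidean f \<longleftrightarrow> continuous_on UNIV f"
    if "Vector_Spaces.linear t (*) f" for f :: "'f \<Rightarrow> 'k"
    using \<T> that by (simp add: compatible_topology_def)
  have top: "topspace \<T> = UNIV"
    and scale: "continuous_map (prod_topology euclidean \<T>) \<T> (\<lambda>(c, x). t c x)"
    using lc by (auto simp: locally_convex_topology_def)
  show ?thesis
  proof
    show "topspace \<T> = UNIV" by (rule top)
    show "continuous_map (prod_topology \<T> \<T>) \<T> (\<lambda>(x, y). x + y)"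
      and "\<And>U. openin \<T> U \<Longrightarrow> 0 \<in> U \<Longrightarrow> \<exists>V. openin \<T> V \<and> 0 \<in> V \<and> V \<subseteq> U \<and> convex V"
      using lc by (auto simp: locally_convex_topology_def)
    have "continuous_map euclideanreal euclidean (of_real :: real \<Rightarrow> 'k)"
      by (simp add: continuous_on_of_real)
    from continuous_map_pairedI[OF continuous_map_compose[OF continuous_map_fst this] continuous_map_snd]
    have "continuous_map (prod_topology euclideanreal \<T>) (prod_topology euclidean \<T>)
        (\<lambda>p. (of_real (fst p) :: 'k, snd p))" by (simp add: o_def)
    from continuous_map_compose[OF this scale]
    show "continuous_map (prod_topology euclideanreal \<T>) \<T> (\<lambda>(r, x). r *\<^sub>R x)"
      by (simp add: o_def case_prod_unfold normed_scalingD(2)[OF t])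
    fix g :: "'f \<Rightarrow> real" assume g: "linear g"
    obtain L :: "'k \<Rightarrow> 'k" where L: "linear L"
      and lin: "Vector_Spaces.linear t (*) (\<lambda>x. L (\<Sum>b\<in>Basis. g (t b x) *\<^sub>R b))"
      and g_eq: "\<And>x. g x = L (\<Sum>b\<in>Basis. g (t b x) *\<^sub>R b) \<bullet> 1"
      by (rule scalar_functional_of_real[OF t g]) (rule that)
    define f where "f x = L (\<Sum>b\<in>Basis. g (t b x) *\<^sub>R b)" for x
    have L_cont: "continuous_on UNIV L" using L by (simp add: linear_continuous_on linear_conv_bounded_linear)
    have inner_cont: "continuous_on UNIV (\<lambda>d :: 'k. d \<bullet> 1)" by (intro continuous_intros)
    have g_f: "g = (\<lambda>d. d \<bullet> 1) \<circ> f" unfolding fun_eq_iff o_def f_def by (intro allI g_eq)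
    have f_iff: "continuous_map \<T> euclidean f \<longleftrightarrow> continuous_on UNIV f"
      unfolding f_def by (rule compat[OF lin])
    show "continuous_map \<T> euclideanreal g \<longleftrightarrow> bounded_linear g"
    proof
      assume cont: "continuous_map \<T> euclideanreal g"
      have "continuous_map \<T> euclidean (\<lambda>x. g (t b x) *\<^sub>R b)" for b
      proof -
        have t_cont: "continuous_map \<T> \<T> (t b)"
          using continuous_map_compose[OF continuous_map_pairedI[OF _ continuous_map_id] scale, of "\<lambda>_. b"]
          by (simp add: o_def)
        have b_cont: "continuous_map euclideanreal euclidean (\<lambda>r. r *\<^sub>R b)"
          unfolding continuous_map_iff_continuous2 by (intro continuous_intros)
        from continuous_map_compose[OF continuous_map_compose[OF t_cont cont] b_cont]
        show ?thesis unfolding o_def .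
      qed
      then have sum_cont: "continuous_map \<T> euclidean (\<lambda>x. \<Sum>b\<in>Basis. g (t b x) *\<^sub>R (b :: 'k))"
        by (intro continuous_map_sum) auto
      have "continuous_map euclidean euclidean L" using L_cont by simp
      from continuous_map_compose[OF sum_cont this] have "continuous_map \<T> euclidean f"
        unfolding o_def f_def[symmetric] .
      then have f_cont: "continuous_on UNIV f" using f_iff by simp
      have "continuous_on UNIV g"
        unfolding g_f by (rule continuous_on_compose[OF f_cont continuous_on_subset[OF inner_cont subset_UNIV]])
      then show "bounded_linear g" by (rule continuous_linear_imp_bounded[OF g])
    next
      assume bl: "bounded_linear g"
      have "continuous_on UNIV (\<lambda>x. g (t b x))" for b
        by (rule linear_continuous_on[OF bounded_linear_compose[OF bl bounded_linear_scaling[OF t]]])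
      then have sum_cont: "continuous_on UNIV (\<lambda>x. \<Sum>b\<in>Basis. g (t b x) *\<^sub>R (b :: 'k))"
        by (intro continuous_intros)
      have "continuous_on UNIV f"
        unfolding f_def by (rule continuous_on_compose2[OF L_cont sum_cont subset_UNIV])
      then have "continuous_map \<T> euclidean f" using f_iff by simp
      then show "continuous_map \<T> euclideanreal g"
        unfolding g_f by (rule continuous_map_compose) (use inner_cont in simp)
    qed
  qed
qed

subsection \<open>Multilinear maps and the projective tensor product\<close>

lemma subspace_scaleR:
  fixes s :: "'k::{real_normed_field, euclidean_space} \<Rightarrow> 'a::real_normed_vector \<Rightarrow> 'a"
  assumes s: "normed_scaling s" and V: "module.subspace s V" and x: "x \<in> V"
  shows "r *\<^sub>R x \<in> V"
proof -
  interpret vector_space s by (rule normed_scalingD(1)[OF s])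
  show ?thesis using subspace_scale[OF V x, of "of_real r"] by (simp add: normed_scalingD(2)[OF s])
qed

text \<open>The coordinates are rescaled one at a time, by induction on the set of rescaled
  indices.\<close>

lemma multilinear_on_scaleR:
  fixes s :: "'k::{real_normed_field, euclidean_space} \<Rightarrow> 'a::real_normed_vector \<Rightarrow> 'a"
    and t :: "'k \<Rightarrow> 'b::real_normed_vector \<Rightarrow> 'b" and x :: "'n::finite \<Rightarrow> 'a"
  assumes s: "normed_scaling s" and t: "normed_scaling t" and E: "\<And>i. module.subspace s (E i)"
    and f: "multilinear_on s t E f" and x: "x \<in> tuples E"
  shows "f (\<lambda>i. r i *\<^sub>R x i) = (\<Prod>i\<in>UNIV. r i) *\<^sub>R f x"
proof -
  have "f (\<lambda>i. if i \<in> I then r i *\<^sub>R x i else x i) = (\<Prod>i\<in>I. r i) *\<^sub>R f x" if "finite I" for I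
    using that
  proof induction
    case (insert j I)
    define w where "w = (\<lambda>i. if i \<in> I then r i *\<^sub>R x i else x i)"
    have w: "w \<in> tuples E" using x subspace_scaleR[OF s E] by (auto simp: w_def tuples_def)
    have "(\<lambda>i. if i \<in> insert j I then r i *\<^sub>R x i else x i) = w(j := s (of_real (r j)) (x j))"
      by (auto simp: w_def normed_scalingD(2)[OF s])
    moreover have "f (w(j := s (of_real (r j)) (x j))) = t (of_real (r j)) (f (w(j := x j)))"
      using f w x by (auto simp: multilinear_on_def tuples_def)
    moreover have "w(j := x j) = w" using insert.hyps by (auto simp: w_def)
    ultimately show ?case using insert by (simp add: w_def normed_scalingD(2)[OF t])
  qed simp
  from this[of UNIV] show ?thesis by simp
qed

section \<open>Elementary tensors and their images in the completion\<close>

lemma tensor_sum_in_alg_tensor_product: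
  "(\<And>j. j < m \<Longrightarrow> X j \<in> tuples E) \<Longrightarrow> (\<lambda>\<phi>. \<Sum>j<(m::nat). tensor s E (X j) \<phi>) \<in> alg_tensor_product s E"
  unfolding alg_tensor_product_def by blast

lemma tensor_in_alg_tensor_product:
  assumes "x \<in> tuples E"
  shows "tensor s E x \<in> alg_tensor_product s E"
  using tensor_sum_in_alg_tensor_product[of 1 "\<lambda>_. x" E s] assms by simp

lemma projective_norm_tensor_le:
  assumes "x \<in> tuples E"
  shows "projective_norm s E (tensor s E x) \<le> (\<Prod>i\<in>UNIV. norm (x i))"
  unfolding projective_norm_def
proof (rule cInf_lower)
  show "(\<Prod>i\<in>UNIV. norm (x i)) \<in> {(\<Sum>j<m. \<Prod>i\<in>UNIV. norm (X j i)) | (m::nat) X.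
      (\<forall>j<m. X j \<in> tuples E) \<and> tensor s E x = (\<lambda>\<phi>. \<Sum>j<m. tensor s E (X j) \<phi>)}"
    using assms by (auto intro!: exI[of _ "1::nat"] exI[of _ "\<lambda>_. x"])
qed (auto intro!: bdd_belowI[of _ 0] sum_nonneg prod_nonneg)

text \<open>Induction from additivity on pairs; the empty sum goes to 0 because its image equals its
  own double.\<close>

lemma projective_tensor_product_sum:
  assumes \<iota>: "projective_tensor_product s E p \<iota>" and X: "\<And>j. j < m \<Longrightarrow> X j \<in> tuples E"
  shows "\<iota> (\<lambda>\<phi>. \<Sum>j<(m::nat). tensor s E (X j) \<phi>) = (\<Sum>j<m. \<iota> (tensor s E (X j)))"
  using X
proof (induction m)
  case 0
  have "(\<lambda>\<phi>. 0) \<in> alg_tensor_product s E" using tensor_sum_in_alg_tensor_product[of 0 _ E s] by simp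
  then have "\<iota> (\<lambda>\<phi>. 0) = \<iota> (\<lambda>\<phi>. 0) + \<iota> (\<lambda>\<phi>. 0)"
    using \<iota> unfolding projective_tensor_product_def by fastforce
  then show ?case by simp
next
  case (Suc m)
  have "\<iota> (\<lambda>\<phi>. (\<lambda>\<phi>. \<Sum>j<m. tensor s E (X j) \<phi>) \<phi> + tensor s E (X m) \<phi>)
      = \<iota> (\<lambda>\<phi>. \<Sum>j<m. tensor s E (X j) \<phi>) + \<iota> (tensor s E (X m))"
    using \<iota> tensor_sum_in_alg_tensor_product[of m X E s] tensor_in_alg_tensor_product[of "X m" E s] Suc.prems
    unfolding projective_tensor_product_def by (meson lessI less_SucI)
  then show ?case using Suc by simp
qed

theorem theorem2p6:
  fixes s :: "'k::{real_normed_field, euclidean_space} \<Rightarrow> 'a::real_normed_vector \<Rightarrow> 'a"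
    and t :: "'k \<Rightarrow> 'f::banach \<Rightarrow> 'f"
    and p :: "'k \<Rightarrow> 'p::banach \<Rightarrow> 'p"
    and E :: "'n::finite \<Rightarrow> 'a set"
    and \<T> :: "'f topology"
    and \<iota> :: "((('n \<Rightarrow> 'a) \<Rightarrow> 'k) \<Rightarrow> 'k) \<Rightarrow> 'p"
    and T :: "('n \<Rightarrow> 'a) \<Rightarrow> 'f"
    and Tt :: "'p \<Rightarrow> 'f"
  assumes "normed_scaling t"
    and "compatible_topology t \<T>"
    and "normed_scaling s"
    and "\<And>i. module.subspace s (E i)"
    and "projective_tensor_product s E p \<iota>"
    and "bounded_multilinear_on s t E T"
    and "bounded_linear Tt"
    and "Vector_Spaces.linear p t Tt"
    and "\<And>x. x \<in> tuples E \<Longrightarrow> Tt (\<iota> (tensor s E x)) = T x"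
  shows "compact_map_wrt \<T> (ball_tuples E) T \<longleftrightarrow> compact_map_wrt \<T> (ball 0 1) Tt"
proof -
  note t = assms(1) and s = assms(3) and E = assms(4) and \<iota> = assms(5) and Tt_T = assms(9)
  interpret norm_compatible_topology \<T> by (rule compatible_topology_real[OF assms(1,2)])
  interpret Tt: bounded_linear Tt by (rule assms(7))
  have ml: "multilinear_on s t E T" using assms(6) by (simp add: bounded_multilinear_on_def)
  have ball_tuplesD: "x \<in> tuples E" "norm (x i) < 1" if "x \<in> ball_tuples E" for x i
    using that by (auto simp: ball_tuples_def tuples_def)
  have norm_\<iota>: "norm (\<iota> u) = projective_norm s E u" if "u \<in> alg_tensor_product s E" for u
    using \<iota> that by (simp add: projective_tensor_product_def)
  show ?thesis
  proof
    assume compact: "compact_map_wrt \<T> (ball 0 1) Tt"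
    have sub: "T ` ball_tuples E \<subseteq> Tt ` ball 0 1"
    proof
      fix y assume "y \<in> T ` ball_tuples E"
      then obtain x where x: "x \<in> ball_tuples E" "y = T x" by blast
      have xE: "x \<in> tuples E" using ball_tuplesD(1)[OF x(1)] .
      have "norm (\<iota> (tensor s E x)) \<le> (\<Prod>i\<in>UNIV. norm (x i))"
        using norm_\<iota>[OF tensor_in_alg_tensor_product[OF xE]] projective_norm_tensor_le[OF xE, of s] by simp
      \<comment> \<open>Strict inequality is needed in one coordinate only; \<open>undefined\<close>
        is merely some index, which exists since types are nonempty.\<close>
      also have "\<dots> < (\<Prod>i\<in>(UNIV :: 'n set). 1)"
        using less_imp_le[OF ball_tuplesD(2)[OF x(1)]] ball_tuplesD(2)[OF x(1)]
        by (intro prod_mono_strict[of undefined]) simp_all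
      finally show "y \<in> Tt ` ball 0 1"
        using Tt_T[OF xE] x(2) by (intro image_eqI[of _ _ "\<iota> (tensor s E x)"]) auto
    qed
    show "compact_map_wrt \<T> (ball_tuples E) T"
      unfolding compact_map_wrt_def
      by (rule closed_compactin[OF compact[unfolded compact_map_wrt_def] closure_of_mono[OF sub]]) simp
  next
    assume compact: "compact_map_wrt \<T> (ball_tuples E) T"
    define S where "S = T ` ball_tuples E"
    define C where "C = \<T> closure_of (convex hull S)"
    obtain B where B: "\<And>x. x \<in> tuples E \<Longrightarrow> norm (T x) \<le> B * (\<Prod>i\<in>UNIV. norm (x i))"
      using assms(6) by (auto simp: bounded_multilinear_on_def)
    have "norm y \<le> \<bar>B\<bar>" if y: "y \<in> S" for y
    proof -
      obtain x where x: "x \<in> ball_tuples E" "y = T x" using y by (auto simp: S_def)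
      have "norm y \<le> B * (\<Prod>i\<in>UNIV. norm (x i))" using B[OF ball_tuplesD(1)[OF x(1)]] x(2) by simp
      also have "\<dots> \<le> \<bar>B\<bar> * 1"
        by (intro mult_mono prod_le_1 prod_nonneg conjI less_imp_le[OF ball_tuplesD(2)[OF x(1)]]) simp_all
      finally show ?thesis by simp
    qed
    then have C: "compactin \<T> C"
      unfolding C_def using compact by (intro Krein) (auto simp: compact_map_wrt_def S_def)
    \<comment> \<open>Rescaling every nonzero factor to norm 1/2, inside the open ball, costs a
      factor 2 per coordinate.\<close>
    define N :: real where "N = 2 ^ CARD('n)"
    have N: "0 < N" by (simp add: N_def)
    \<comment> \<open>The point 0 will absorb the weight missing from sums of coefficients below
      1.\<close>
    have zero: "0 \<in> convex hull S"
    proof (rule hull_inc)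
      have "0 \<in> E i" for i
      proof -
        interpret vector_space s by (rule normed_scalingD(1)[OF s])
        show ?thesis by (rule subspace_0[OF E])
      qed
      then have x0: "(\<lambda>_. 0) \<in> ball_tuples E" by (simp add: ball_tuples_def)
      have "norm (T (\<lambda>_. 0)) \<le> 0" using B[OF ball_tuplesD(1)[OF x0]] by (simp add: zero_power)
      then show "0 \<in> S" using x0 by (auto simp: S_def intro!: image_eqI[of _ _ "\<lambda>_. 0"])
    qed
    have alg: "(1 / N) *\<^sub>R Tt (\<iota> u) \<in> convex hull S"
      if u: "u \<in> alg_tensor_product s E" "norm (\<iota> u) < 1" for u
    proof -
      \<comment> \<open>The projective norm is an infimum, so a norm below 1 gives a representation
        of total weight below 1.\<close>
      have "\<exists>a\<in>{(\<Sum>j<m. \<Prod>i\<in>UNIV. norm (X j i)) | (m::nat) X.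
           (\<forall>j<m. X j \<in> tuples E) \<and> u = (\<lambda>\<phi>. \<Sum>j<m. tensor s E (X j) \<phi>)}. a < 1"
        by (rule cInf_lessD)
          (use u norm_\<iota>[OF u(1)] in \<open>auto simp: projective_norm_def alg_tensor_product_def\<close>)
      then obtain m :: nat and X where X: "\<And>j. j < m \<Longrightarrow> X j \<in> tuples E"
        and u_eq: "u = (\<lambda>\<phi>. \<Sum>j<m. tensor s E (X j) \<phi>)"
        and less: "(\<Sum>j<m. \<Prod>i\<in>UNIV. norm (X j i)) < 1" by auto
      define a where "a j = (\<Prod>i\<in>UNIV. norm (X j i))" for j
      \<comment> \<open>A zero factor stays zero, as \<open>inverse 0 = 0\<close>; the identity for
        \<open>X j\<close> below still holds then.\<close>
      define Y where "Y j i = inverse (2 * norm (X j i)) *\<^sub>R X j i" for j i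
      have Y: "Y j \<in> ball_tuples E" if "j < m" for j
      proof -
        have "norm (Y j i) < 1" for i by (cases "X j i = 0") (simp_all add: Y_def field_simps)
        then show ?thesis
          using X[OF that] subspace_scaleR[OF s E] by (auto simp: ball_tuples_def tuples_def Y_def)
      qed
      have TX: "T (X j) = N *\<^sub>R a j *\<^sub>R T (Y j)" if "j < m" for j
      proof -
        have "X j i = (2 * norm (X j i)) *\<^sub>R Y j i" for i
          by (cases "X j i = 0") (simp_all add: Y_def)
        then have "X j = (\<lambda>i. (2 * norm (X j i)) *\<^sub>R Y j i)" by (rule ext)
        then have "T (X j) = T (\<lambda>i. (2 * norm (X j i)) *\<^sub>R Y j i)" by (rule arg_cong)
        also have "\<dots> = (\<Prod>i\<in>UNIV. 2 * norm (X j i)) *\<^sub>R T (Y j)"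
          by (rule multilinear_on_scaleR[OF s t E ml ball_tuplesD(1)[OF Y[OF that]]])
        finally show ?thesis by (simp add: prod.distrib N_def a_def)
      qed
      have \<iota>_u: "\<iota> u = (\<Sum>j<m. \<iota> (tensor s E (X j)))"
        unfolding u_eq by (rule projective_tensor_product_sum[OF \<iota> X])
      have "Tt (\<iota> u) = (\<Sum>j<m. T (X j))"
        unfolding \<iota>_u Tt.sum by (rule sum.cong) (auto simp: Tt_T X)
      also have "\<dots> = N *\<^sub>R (\<Sum>j<m. a j *\<^sub>R T (Y j))" unfolding scaleR_sum_right by (rule sum.cong) (auto simp: TX)
      finally have eq: "(1 / N) *\<^sub>R Tt (\<iota> u) = (\<Sum>j<m. a j *\<^sub>R T (Y j))" using N by simp
      \<comment> \<open>The remaining weight sits at index \<open>m\<close>, on the point 0.\<close>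
      define b y where "b j = (if j < m then a j else 1 - (\<Sum>j<m. a j))"
        and "y j = (if j < m then T (Y j) else 0)" for j
      have "(\<Sum>j<Suc m. b j *\<^sub>R y j) \<in> convex hull S"
      proof (rule convex_sum)
        show "sum b {..<Suc m} = 1" by (simp add: b_def)
        show "0 \<le> b j" for j using less by (auto simp: b_def a_def prod_nonneg)
        show "y j \<in> convex hull S" for j using zero Y by (auto simp: y_def S_def hull_inc)
      qed auto
      then show ?thesis unfolding eq by (simp add: b_def y_def)
    qed
    have "Tt ` ball 0 1 \<subseteq> {x \<in> topspace \<T>. 0 + (1 / N) *\<^sub>R x \<in> C}"
    proof
      fix y assume "y \<in> Tt ` ball 0 1"
      then obtain u where u: "u \<in> ball 0 1" "y = Tt u" by blast
      \<comment> \<open>Intersecting the dense image of the algebraic tensor product with the open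
        ball keeps it dense there, so the estimate extends by continuity.\<close>
      let ?A = "ball 0 1 \<inter> \<iota> ` alg_tensor_product s E"
      have "u \<in> closure ?A"
        using u(1) open_Int_closure_subset[OF open_ball, of "0 :: 'p" 1 "\<iota> ` alg_tensor_product s E"] \<iota>
        by (auto simp: projective_tensor_product_def)
      moreover have "(\<lambda>u. (1 / N) *\<^sub>R Tt u) ` closure ?A \<subseteq> closure (convex hull S)"
      proof (rule image_closure_subset)
        show "continuous_on (closure ?A) (\<lambda>u. (1 / N) *\<^sub>R Tt u)"
          by (intro continuous_intros Tt.continuous_on continuous_on_id)
        show "(\<lambda>u. (1 / N) *\<^sub>R Tt u) ` ?A \<subseteq> closure (convex hull S)"
          using alg closure_subset by fastforce
      qed simp
      ultimately have "(1 / N) *\<^sub>R y \<in> closure (convex hull S)" using u(2) by blast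
      then show "y \<in> {x \<in> topspace \<T>. 0 + (1 / N) *\<^sub>R x \<in> C}"
        using closure_convex_subset[of "convex hull S"] by (auto simp: C_def)
    qed
    then have "\<T> closure_of (Tt ` ball 0 1) \<subseteq> {x \<in> topspace \<T>. 0 + (1 / N) *\<^sub>R x \<in> C}"
      by (intro closure_of_minimal closedin_continuous_map_preimage[OF continuous_affine]) (auto simp: C_def)
    \<comment> \<open>The closed set is \<open>C\<close> scaled by \<open>N\<close>, hence a
      continuous image of a compact set.\<close>
    also have "\<dots> = (\<lambda>x. 0 + N *\<^sub>R x) ` C" using N by (force simp: image_iff)
    finally have "\<T> closure_of (Tt ` ball 0 1) \<subseteq> (\<lambda>x. 0 + N *\<^sub>R x) ` C" .
    then show "compact_map_wrt \<T> (ball 0 1) Tt"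
      unfolding compact_map_wrt_def
      by (rule closed_compactin[OF image_compactin[OF C continuous_affine]]) simp
  qed
qed

end
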